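(* Under the Setup and the Conditional asymptotic regime described in the context, for $i=0,1$, $$\lim_{p\to\infty} E_{S_n}[\hat\varepsilon_i^B\mid \boldsymbol\mu]=\Phi\!\left((-1)^i\,\frac{-G_i^B+c}{\sqrt{D}}\right),$$ and consequently $$\lim_{p\to\infty} E_{S_n}[\hat\varepsilon^B\mid \boldsymbol\mu]=\alpha_0\,\Phi\!\left(\frac{-G_0^B+c}{\sqrt D}\right)+\alpha_1\,\Phi\!\left(\frac{G_1^B-c}{\sqrt D}\right),$$ where $$G_0^B=\frac{1}{2(1+\gamma_0)}\Big(\gamma_0(\bar\eta_{\mathbf m_0,\boldsymbol\mu_1}-\bar\eta_{\mathbf m_0,\boldsymbol\mu_0})+\bar\delta^2_{\boldsymbol\mu}+(1-\gamma_0)J_0+(1+\gamma_0)J_1\Big),$$ $$G_1^B=\frac{-1}{2(1+\gamma_1)}\Big(\gamma_1(\bar\eta_{\mathbf m_1,\boldsymbol\mu_0}-\bar\eta_{\mathbf m_1,\boldsymbol\mu_1})+\bar\delta^2_{\boldsymbol\mu}+(1-\gamma_1)J_1+(1+\gamma_1)J_0\Big),$$ $$D=\bar\delta^2_{\boldsymbol\mu}+J_0+J_1 .$$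
   Context: Setup. Fix $\alpha_0\in(0,1)$, $\alpha_1=1-\alpha_0$, and $c=\log\frac{1-\alpha_0}{\alpha_0}$. $\Phi$ is the standard normal CDF. For each dimension $p$ there is a known symmetric positive definite $p\times p$ matrix $\Sigma$, class means $\boldsymbol\mu_0,\boldsymbol\mu_1\in\mathbb R^p$, sample sizes $n_0,n_1$, prior means $\mathbf m_0,\mathbf m_1\in\mathbb R^p$ and prior certainty parameters $\nu_0,\nu_1>0$ (all depending on $p$; the index $p$ is suppressed). Class $i$ has distribution $\Pi_i=N(\boldsymbol\mu_i,\Sigma)$. The sample $S_n$ consists of $n_0$ i.i.d. points from $\Pi_0$ and, independently, $n_1$ i.i.d. points from $\Pi_1$; $\bar{\mathbf x}_0,\bar{\mathbf x}_1$ are the class sample means. The LDA classifier assigns $\mathbf x$ to class 1 if $W(\mathbf x)\le c$ and to class 0 otherwise, where $W(\mathbf x)=(\mathbf x-\frac{\bar{\mathbf x}_0+\bar{\mathbf x}_1}{2})^T\Sigma^{-1}(\bar{\mathbf x}_0-\bar{\mathbf x}_1)$. Let $\hat\delta^2=(\bar{\mathbf x}_0-\bar{\mathbf x}_1)^T\Sigma^{-1}(\bar{\mathbf x}_0-\bar{\mathbf x}_1)$. The true error is $\varepsilon=\alpha_0\varepsilon_0+\alpha_1\varepsilon_1$ with $\varepsilon_i=\Phi\Big(\frac{(-1)^{i+1}(\boldsymbol\mu_i-\frac{\bar{\mathbf x}_0+\bar{\mathbf x}_1}{2})^T\Sigma^{-1}(\bar{\mathbf x}_0-\bar{\mathbf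 x}_1)+(-1)^i c}{\hat\delta}\Big)$. The Bayesian MMSE error estimator (for the prior $\boldsymbol\mu_i\sim N(\mathbf m_i,\Sigma/\nu_i)$, $i=0,1$, independent) is $\hat\varepsilon^B=\alpha_0\hat\varepsilon^B_0+\alpha_1\hat\varepsilon^B_1$ with $\hat\varepsilon_i^B=\Phi\Big((-1)^i\frac{-(\mathbf m_i^*-\frac{\bar{\mathbf x}_0+\bar{\mathbf x}_1}{2})^T\Sigma^{-1}(\bar{\mathbf x}_0-\bar{\mathbf x}_1)+c}{\hat\delta}\sqrt{\frac{\nu_i^*}{\nu_i^*+1}}\Big)$, where $\mathbf m_i^*=\frac{n_i\bar{\mathbf x}_i+\nu_i\mathbf m_i}{n_i+\nu_i}$ and $\nu_i^*=n_i+\nu_i$. Notation: $\eta_{\mathbf a,\mathbf b}=(\mathbf a-\mathbf b)^T\Sigma^{-1}(\mathbf a-\mathbf b)$, $\delta^2_{\boldsymbol\mu}=\eta_{\boldsymbol\mu_0,\boldsymbol\mu_1}$; a bar denotes the limit as $p\to\infty$ of the corresponding quantity. Conditional asymptotic regime. $\boldsymbol\mu_0,\boldsymbol\mu_1$ are deterministic for each $p$, and expectations $E_{S_n}[\cdot\mid\boldsymbol\mu]$ are over the sample only. As $p\to\infty$: $n_0,n_1,\nu_0,\nu_1\to\infty$, $p/n_i\to J_i\in[0,\infty)$, $\nu_i/n_i\to\gamma_i\in[0,\infty)$, and for all $i,j\in\{0,1\}$ the quantities $\mathbf m_i^T\Sigma^{-1}\boldsymbol\mu_j$, $\mathbf m_i^T\Sigma^{-1}\mathbf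 m_j$, $\boldsymbol\mu_i^T\Sigma^{-1}\boldsymbol\mu_j$ converge to finite limits (so all the $\eta$'s above converge). It is assumed that $D=\bar\delta^2_{\boldsymbol\mu}+J_0+J_1>0$. $\lim_{p\to\infty}$ denotes the limit along this regime. *)

theory Defs
  imports "HOL-Probability.Probability" "Jordan_Normal_Form.Determinant"
begin

definition Phi :: "real \<Rightarrow> real" where
  "Phi x = measure (density lborel std_normal_density) {..x}"

definition minv :: "real mat \<Rightarrow> real mat" where
  "minv S = (SOME B. B \<in> carrier_mat (dim_row S) (dim_row S) \<and>
                     S * B = 1\<^sub>m (dim_row S) \<and> B * S = 1\<^sub>m (dim_row S))"

text \<open>Vectors of R^p are represented as functions nat => real, only indices < p matter.
  qform p S a b = a^T S^{-1} b.\<close>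
definition qform :: "nat \<Rightarrow> real mat \<Rightarrow> (nat \<Rightarrow> real) \<Rightarrow> (nat \<Rightarrow> real) \<Rightarrow> real" where
  "qform p S a b = (\<Sum>i<p. \<Sum>j<p. a i * (minv S $$ (i,j)) * b j)"

definition eta :: "nat \<Rightarrow> real mat \<Rightarrow> (nat \<Rightarrow> real) \<Rightarrow> (nat \<Rightarrow> real) \<Rightarrow> real" where
  "eta p S a b = qform p S (\<lambda>j. a j - b j) (\<lambda>j. a j - b j)"

definition spd :: "nat \<Rightarrow> real mat \<Rightarrow> bool" where
  "spd p S \<longleftrightarrow> S \<in> carrier_mat p p \<and> (\<forall>i<p. \<forall>j<p. S $$ (i,j) = S $$ (j,i)) \<and>
     (\<forall>x::nat \<Rightarrow> real. (\<exists>i<p. x i \<noteq> 0) \<longrightarrow> (\<Sum>i<p. \<Sum>j<p. x i * S $$ (i,j) * x j) > 0)"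

definition gauss_density :: "nat \<Rightarrow> (nat \<Rightarrow> real) \<Rightarrow> real mat \<Rightarrow> (nat \<Rightarrow> real) \<Rightarrow> real" where
  "gauss_density p mu S x =
     exp (- eta p S x mu / 2) / sqrt ((2 * pi) ^ p * det S)"

definition gauss :: "nat \<Rightarrow> (nat \<Rightarrow> real) \<Rightarrow> real mat \<Rightarrow> (nat \<Rightarrow> real) measure" where
  "gauss p mu S = density (PiM {..<p} (\<lambda>_. lborel)) (\<lambda>x. ennreal (gauss_density p mu S x))"

definition sample_distr :: "nat \<Rightarrow> nat \<Rightarrow> nat \<Rightarrow> (nat \<Rightarrow> real) \<Rightarrow> (nat \<Rightarrow> real) \<Rightarrow> real mat
    \<Rightarrow> ((nat \<Rightarrow> nat \<Rightarrow> real) \<times> (nat \<Rightarrow> nat \<Rightarrow> real)) measure" where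
  "sample_distr p n0 n1 mu0 mu1 S =
     (PiM {..<n0} (\<lambda>_. gauss p mu0 S)) \<Otimes>\<^sub>M (PiM {..<n1} (\<lambda>_. gauss p mu1 S))"

definition smean :: "nat \<Rightarrow> (nat \<Rightarrow> nat \<Rightarrow> real) \<Rightarrow> nat \<Rightarrow> real" where
  "smean n xs = (\<lambda>j. (\<Sum>k<n. xs k j) / real n)"

text \<open>Class-i Bayesian MMSE error estimator for LDA, given class-i data (sample size ni,
  prior mean mi, prior certainty nui), threshold c and sample means xb0, xb1.\<close>
definition bayes_eps :: "nat \<Rightarrow> real \<Rightarrow> nat \<Rightarrow> real mat \<Rightarrow> nat \<Rightarrow> real \<Rightarrow> (nat \<Rightarrow> real)
    \<Rightarrow> (nat \<Rightarrow> real) \<Rightarrow> (nat \<Rightarrow> real) \<Rightarrow> real" where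
  "bayes_eps i c p S ni nui mi xb0 xb1 =
     (let xbi = (if i = 0 then xb0 else xb1);
          mstar = (\<lambda>j. (real ni * xbi j + nui * mi j) / (real ni + nui));
          nustar = real ni + nui;
          mid = (\<lambda>j. (xb0 j + xb1 j) / 2);
          dif = (\<lambda>j. xb0 j - xb1 j);
          dhat = sqrt (qform p S dif dif)
      in Phi ((-1) ^ i * ((- qform p S (\<lambda>j. mstar j - mid j) dif + c) / dhat)
                * sqrt (nustar / (nustar + 1))))"

end

theory Submission
  imports Defs
begin

text \<open>
  A triangular factorisation of the inverse covariance matrix turns the sample into independent
  standard normal coordinates, so the whitened class means are independent \<open>N(0, 1/n)\<close>
  variables.  Second moments then show that every quadratic form in the sample means and prior
  means converges in probability; the only non-vanishing sampling effect is that
  \<open>z\<^sub>i\<^sup>T \<Sigma>\<^sup>-\<^sup>1 z\<^sub>i\<close>, with \<open>z\<^sub>i\<close> the deviation of the \<open>i\<close>-th sample mean from its mean,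
  tends to \<open>J\<^sub>i\<close>.  The error estimator is a bounded continuous function of
  these forms, so its expectation converges to its value at the limits.
\<close>

section \<open>Whitening a positive definite matrix\<close>

text \<open>Each dimension \<open>p\<close> has its own sample space, and the Gaussian law is given
  only as a density against a product of Lebesgue measures. Two choices answer these obstacles. With
  the inverse covariance written as \<open>W^T W\<close>, \<open>W\<close> lower triangular, the
  change of variables splits into one-dimensional affine substitutions. Convergence in probability
  is phrased on pairs \<open>(p, s)\<close>, so that one filter covers all the spaces. The deviation
  of a class mean has a squared norm that is a multiple \<open>1/n_i\<close> of a chi-square
  variable with \<open>p\<close> degrees of freedom: its mean \<open>p/n_i\<close> need not vanish,
  its variance \<open>2p/n_i^2\<close> does. Hence \<open>D\<close> contains both \<open>J_0\<close>
  and \<open>J_1\<close>. In the numerator for class 0, \<open>J_0\<close> enters with weight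
  \<open>1/(1+\<gamma>_0)\<close> through the posterior mean and with weight \<open>-1/2\<close>
  through the midpoint; the sum \<open>(1-\<gamma>_0)/(2(1+\<gamma>_0))\<close> is its coefficient
  in \<open>G_0\<close>, while \<open>J_1\<close> enters through the midpoint alone, with weight
  \<open>1/2\<close>. The factor with the square root tends to 1 and leaves no trace.\<close>

lemma cholesky_exists:
  fixes A :: "nat \<Rightarrow> nat \<Rightarrow> real"
  assumes "\<And>i j. i < p \<Longrightarrow> j < p \<Longrightarrow> A i j = A j i"
    and "\<And>x::nat \<Rightarrow> real. \<exists>i<p. x i \<noteq> 0 \<Longrightarrow> (\<Sum>i<p. \<Sum>j<p. x i * A i j * x j) > 0"
  shows "\<exists>W::nat \<Rightarrow> nat \<Rightarrow> real. (\<forall>j<p. 0 < W j j) \<and> (\<forall>j l. j < l \<longrightarrow> W j l = 0) \<and>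
           (\<forall>l<p. \<forall>m<p. A l m = (\<Sum>j<p. W j l * W j m))"
  using assms
proof (induction p arbitrary: A)
  case 0
  show ?case by (intro exI[of _ "\<lambda>_ _. 0"]) simp
next
  case (Suc p)
  note sym = Suc.prems(1)
  define a where "a = A p p"
  \<comment> \<open>Test vector: the last unit vector, at which the form takes the value of the
    pivot.\<close>
  have "(\<Sum>i<Suc p. \<Sum>j<Suc p. (if i = p then 1 else 0) * A i j * (if j = p then 1 else 0)) > 0"
    by (rule Suc.prems(2)) auto
  then have a: "a > 0" by (simp add: a_def)
  \<comment> \<open>Schur complement of the last pivot. Eliminating the last index first is what
    makes the factor \<open>W\<close> in \<open>W^T W\<close> lower triangular.\<close>
  define A' where "A' i j = A i j - A p i * A p j / a" for i j
  have pos': "(\<Sum>i<p. \<Sum>j<p. x i * A' i j * x j) > 0" if x: "\<exists>i<p. x i \<noteq> 0" for x :: "nat \<Rightarrow> real"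
  proof -
    define s where "s = (\<Sum>l<p. A p l * x l)"
    define Q where "Q = (\<Sum>i<p. \<Sum>j<p. x i * A i j * x j)"
    \<comment> \<open>The value \<open>- s / a\<close> minimises the form of \<open>A\<close> in the
      last coordinate; the minimum \<open>Q - s * s / a\<close> is the form of \<open>A'\<close> at
      \<open>x\<close>.\<close>
    define y where "y = x(p := - s / a)"
    have "(\<Sum>i<Suc p. \<Sum>j<Suc p. y i * A i j * y j) > 0"
      using x by (intro Suc.prems(2)) (auto simp: y_def intro: less_SucI)
    also have "(\<Sum>i<Suc p. \<Sum>j<Suc p. y i * A i j * y j)
      = Q + (\<Sum>i<p. x i * A i p * (- s / a)) + (\<Sum>j<p. (- s / a) * A p j * x j) + (- s / a) * a * (- s / a)"
      by (simp add: y_def Q_def a_def sum.distrib sum_subtractf sum_negf)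
    also have "(\<Sum>i<p. x i * A i p * (- s / a)) = s * (- s / a)"
      unfolding s_def sum_distrib_right by (intro sum.cong) (auto simp: sym[of _ p])
    also have "(\<Sum>j<p. (- s / a) * A p j * x j) = (- s / a) * s"
      unfolding s_def sum_distrib_left by (intro sum.cong) (auto simp: mult.assoc)
    also have "Q + s * (- s / a) + (- s / a) * s + (- s / a) * a * (- s / a) = Q - s * s / a"
      using a by (simp add: field_simps)
    also have "s * s / a = (\<Sum>i<p. \<Sum>j<p. x i * (A p i * A p j / a) * x j)"
      unfolding s_def sum_product sum_divide_distrib by (intro sum.cong) auto
    also have "Q - \<dots> = (\<Sum>i<p. \<Sum>j<p. x i * A' i j * x j)"
      unfolding Q_def sum_subtractf[symmetric]
      by (intro sum.cong) (auto simp: A'_def algebra_simps)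
    finally show ?thesis .
  qed
  have "\<exists>W::nat \<Rightarrow> nat \<Rightarrow> real. (\<forall>j<p. 0 < W j j) \<and> (\<forall>j l. j < l \<longrightarrow> W j l = 0) \<and>
           (\<forall>l<p. \<forall>m<p. A' l m = (\<Sum>j<p. W j l * W j m))"
    by (rule Suc.IH[OF _ pos']) (auto simp: A'_def sym)
  then obtain W :: "nat \<Rightarrow> nat \<Rightarrow> real" where W: "\<And>j. j < p \<Longrightarrow> 0 < W j j" "\<And>j l. j < l \<Longrightarrow> W j l = 0"
     "\<And>l m. l < p \<Longrightarrow> m < p \<Longrightarrow> A' l m = (\<Sum>j<p. W j l * W j m)" by metis
  \<comment> \<open>The new row. Cutting it off beyond column \<open>p\<close> keeps the zero
    pattern for every column index, also outside the dimension.\<close>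
  define V where "V = W(p := (\<lambda>l. if l \<le> p then A p l / sqrt a else 0))"
  have "A l m = (\<Sum>j<Suc p. V j l * V j m)" if "l < Suc p" "m < Suc p" for l m
  proof -
    have "(\<Sum>j<Suc p. V j l * V j m) = (\<Sum>j<p. W j l * W j m) + A p l * A p m / a"
      using that a by (simp add: V_def)
    moreover have "(\<Sum>j<p. W j l * W j m) = A l m - A p l * A p m / a"
    proof (cases "l = p \<or> m = p")
      case True
      \<comment> \<open>The older rows vanish in column \<open>p\<close>, so the new row alone must
        produce the last row and column of \<open>A\<close>.\<close>
      then have "(\<Sum>j<p. W j l * W j m) = 0" by (intro sum.neutral) (auto simp: W(2))
      with True show ?thesis using a that sym[of l p] by (auto simp: a_def)
    next
      case False
      with that show ?thesis by (simp add: W(3)[symmetric] A'_def)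
    qed
    ultimately show ?thesis by simp
  qed
  moreover have "V j j > 0" if "j < Suc p" for j
    using that W(1) a by (auto simp: V_def less_Suc_eq simp flip: a_def)
  moreover have "V j l = 0" if "j < l" for j l
    using that W(2) by (auto simp: V_def)
  ultimately show ?case by blast
qed

section \<open>Inverse of the covariance matrix\<close>

lemma mult_mat_index_sum:
  fixes A B :: "'a::semiring_0 mat"
  assumes "A \<in> carrier_mat p p" "B \<in> carrier_mat p p" "i < p" "j < p"
  shows "(A * B) $$ (i, j) = (\<Sum>k<p. A $$ (i, k) * B $$ (k, j))"
  using assms by (auto simp: scalar_prod_def lessThan_atLeast0 intro!: sum.cong)

text \<open>A nonzero kernel vector would annul the quadratic form.\<close>

lemma spd_det_nonzero:
  assumes "spd p S"
  shows "det S \<noteq> 0"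
proof
  have S: "S \<in> carrier_mat p p" using assms by (simp add: spd_def)
  assume "det S = 0"
  then obtain v where v: "v \<in> carrier_vec p" "v \<noteq> 0\<^sub>v p" "S *\<^sub>v v = 0\<^sub>v p"
    using det_0_iff_vec_prod_zero[OF S] by blast
  have z: "(\<Sum>j<p. S $$ (i, j) * vec_index v j) = 0" if "i < p" for i
  proof -
    have "vec_index (S *\<^sub>v v) i = (\<Sum>j<p. S $$ (i, j) * vec_index v j)"
      using S v(1) that by (auto simp: scalar_prod_def lessThan_atLeast0 intro!: sum.cong)
    with v(3) that show ?thesis by simp
  qed
  have "\<exists>i<p. vec_index v i \<noteq> 0"
    using v(1,2) by (metis carrier_vecD eq_vecI index_zero_vec(1,2))
  then have "(\<Sum>i<p. \<Sum>j<p. vec_index v i * S $$ (i,j) * vec_index v j) > 0"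
    using assms unfolding spd_def by blast
  also have "(\<Sum>i<p. \<Sum>j<p. vec_index v i * S $$ (i,j) * vec_index v j) = 0"
    using z by (intro sum.neutral) (auto simp: mult.assoc simp flip: sum_distrib_left)
  finally show False by simp
qed

text \<open>Invertibility gives the choice in \<open>minv\<close> a witness, so the chosen matrix
  really is an inverse.\<close>

lemma minv_inverse:
  assumes "spd p S"
  shows "minv S \<in> carrier_mat p p" "S * minv S = 1\<^sub>m p" "minv S * S = 1\<^sub>m p"
proof -
  have S: "S \<in> carrier_mat p p" using assms by (simp add: spd_def)
  have "\<exists>B. B \<in> carrier_mat p p \<and> S * B = 1\<^sub>m p \<and> B * S = 1\<^sub>m p"
    using det_non_zero_imp_unit[OF S spd_det_nonzero[OF assms], of "()"]
    by (auto simp: Units_def ring_mat_def)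
  then have "\<exists>B. B \<in> carrier_mat (dim_row S) (dim_row S) \<and>
     S * B = 1\<^sub>m (dim_row S) \<and> B * S = 1\<^sub>m (dim_row S)" using S by simp
  from someI_ex[OF this] show "minv S \<in> carrier_mat p p" "S * minv S = 1\<^sub>m p" "minv S * S = 1\<^sub>m p"
    using S by (auto simp: minv_def)
qed

lemma minv_sym:
  assumes "spd p S" "i < p" "j < p"
  shows "minv S $$ (i, j) = minv S $$ (j, i)"
proof -
  have S: "S \<in> carrier_mat p p" "S\<^sup>T = S" using assms(1) by (auto simp: spd_def)
  note B = minv_inverse[OF assms(1)]
  let ?B = "minv S"
  have BT: "?B\<^sup>T \<in> carrier_mat p p" using B(1) by simp
  have "?B\<^sup>T * S = 1\<^sub>m p"
    using transpose_mult[OF S(1) B(1)] B(2) S(2) by simp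
  then have "?B\<^sup>T = ?B"
    using assoc_mult_mat[OF BT S(1) B(1)] B(1,2) BT by simp
  then have "?B $$ (i, j) = ?B\<^sup>T $$ (i, j)" by simp
  then show ?thesis using assms(2,3) B(1) by simp
qed

text \<open>With \<open>x\<close> the inverse applied to \<open>y\<close>, the form of the inverse
  at \<open>y\<close> equals the form of \<open>S\<close> at \<open>x\<close>; and \<open>x\<close>
  is nonzero because \<open>S\<close> sends it back to \<open>y\<close>.\<close>

lemma minv_pos:
  assumes "spd p S" and y: "\<exists>i<p. y i \<noteq> (0::real)"
  shows "(\<Sum>i<p. \<Sum>j<p. y i * minv S $$ (i, j) * y j) > 0"
proof -
  have S: "S \<in> carrier_mat p p" using assms(1) by (auto simp: spd_def)
  note B = minv_inverse[OF assms(1)]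
  define x where "x i = (\<Sum>j<p. minv S $$ (i, j) * y j)" for i
  have Sx: "(\<Sum>j<p. S $$ (i, j) * x j) = y i" if "i < p" for i
  proof -
    have "(\<Sum>j<p. S $$ (i, j) * x j) = (\<Sum>j<p. \<Sum>k<p. S $$ (i, j) * minv S $$ (j, k) * y k)"
      by (simp add: x_def sum_distrib_left mult.assoc)
    also have "\<dots> = (\<Sum>k<p. (S * minv S) $$ (i, k) * y k)"
      using that by (subst sum.swap) (simp add: mult_mat_index_sum[OF S B(1)] sum_distrib_right)
    also have "\<dots> = (\<Sum>k<p. if k = i then y k else 0)"
      unfolding B(2) using that by (intro sum.cong) auto
    finally show ?thesis using that by simp
  qed
  have "\<exists>i<p. x i \<noteq> 0"
  proof (rule ccontr)
    assume "\<not> ?thesis"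
    then have "y i = 0" if "i < p" for i using Sx[OF that] by simp
    with y show False by blast
  qed
  then have "0 < (\<Sum>i<p. \<Sum>j<p. x i * S $$ (i,j) * x j)"
    using assms(1) unfolding spd_def by blast
  also have "\<dots> = (\<Sum>i<p. y i * x i)"
    by (intro sum.cong refl) (auto simp: Sx mult.assoc simp flip: sum_distrib_left)
  also have "\<dots> = (\<Sum>i<p. \<Sum>j<p. y i * minv S $$ (i, j) * y j)"
    by (simp add: x_def sum_distrib_left mult.assoc)
  finally show ?thesis .
qed

text \<open>Cholesky is applied to the inverse rather than to \<open>S\<close>: then
  \<open>qform\<close> is the plain dot product of \<open>W a\<close> and \<open>W b\<close>, and
  the determinant identity turns the Gaussian normaliser into the diagonal product, which is also
  the Jacobian of \<open>W\<close>.\<close>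

lemma whitening_exists:
  assumes "spd p S"
  obtains W :: "nat \<Rightarrow> nat \<Rightarrow> real"
  where "\<And>j. j < p \<Longrightarrow> 0 < W j j" "\<And>j l. j < l \<Longrightarrow> W j l = 0"
    "\<And>a b. qform p S a b = (\<Sum>j<p. (\<Sum>l<p. W j l * a l) * (\<Sum>l<p. W j l * b l))"
    "det S * (\<Prod>j<p. W j j)\<^sup>2 = 1"
proof -
  have S: "S \<in> carrier_mat p p" using assms by (simp add: spd_def)
  note B = minv_inverse[OF assms]
  obtain W :: "nat \<Rightarrow> nat \<Rightarrow> real" where W: "\<And>j. j < p \<Longrightarrow> 0 < W j j" "\<And>j l. j < l \<Longrightarrow> W j l = 0"
     "\<And>l m. l < p \<Longrightarrow> m < p \<Longrightarrow> minv S $$ (l, m) = (\<Sum>j<p. W j l * W j m)"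
    using cholesky_exists[of p "\<lambda>i j. minv S $$ (i, j)", OF minv_sym[OF assms] minv_pos[OF assms]]
    by metis
  have q: "qform p S a b = (\<Sum>j<p. (\<Sum>l<p. W j l * a l) * (\<Sum>l<p. W j l * b l))" for a b
  proof -
    have "qform p S a b = (\<Sum>l<p. \<Sum>m<p. \<Sum>j<p. (W j l * a l) * (W j m * b m))"
      unfolding qform_def
      by (intro sum.cong refl) (simp add: W(3) sum_distrib_left sum_distrib_right ac_simps)
    also have "\<dots> = (\<Sum>j<p. \<Sum>l<p. \<Sum>m<p. (W j l * a l) * (W j m * b m))"
      by (rule trans[OF sum.cong[OF refl sum.swap] sum.swap])
    finally show ?thesis by (simp add: sum_product)
  qed
  define V where "V = mat p p (\<lambda>(i, j). W i j)"
  have V: "V \<in> carrier_mat p p" by (simp add: V_def)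
  have BV: "minv S = V\<^sup>T * V"
  proof (rule eq_matI)
    fix i j assume "i < dim_row (V\<^sup>T * V)" "j < dim_col (V\<^sup>T * V)"
    then have ij: "i < p" "j < p" by (simp_all add: V_def)
    show "minv S $$ (i, j) = (V\<^sup>T * V) $$ (i, j)"
      using ij by (simp add: mult_mat_index_sum[OF _ V] V W(3)) (simp add: V_def)
  qed (use B(1) V in auto)
  have "det V = prod_list (diag_mat V)"
    by (rule det_lower_triangular[OF _ V]) (auto simp: V_def W(2))
  also have "\<dots> = (\<Prod>j<p. W j j)"
    unfolding prod_list_diag_prod by (auto simp: V_def lessThan_atLeast0 intro!: prod.cong)
  finally have dV: "det V = (\<Prod>j<p. W j j)" .
  have "det (minv S) = (\<Prod>j<p. W j j)\<^sup>2"
    unfolding BV using det_mult[of "V\<^sup>T" p V] V dV det_transpose[OF V] by (simp add: power2_eq_square)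
  then have "det S * (\<Prod>j<p. W j j)\<^sup>2 = 1"
    using det_mult[OF S B(1)] B(2) by simp
  with W(1,2) q show ?thesis using that by blast
qed

section \<open>Gaussian measures\<close>

definition whiten :: "(nat \<Rightarrow> nat \<Rightarrow> real) \<Rightarrow> nat \<Rightarrow> (nat \<Rightarrow> real) \<Rightarrow> (nat \<Rightarrow> real) \<Rightarrow> nat \<Rightarrow> real" where
  "whiten W p mu x j = (\<Sum>l<p. W j l * (x l - mu l))"

abbreviation std_gauss :: "real measure" where
  "std_gauss \<equiv> density lborel (\<lambda>x. ennreal (std_normal_density x))"

lemma borel_measurable_whiten [measurable]:
  "(\<lambda>x. whiten W p mu x j) \<in> borel_measurable (PiM {..<p} (\<lambda>_. lborel))"
  unfolding whiten_def by measurable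

lemma measurable_restrict_whiten:
  "(\<lambda>x. \<lambda>j\<in>{..<p}. whiten W p mu x j) \<in> measurable (PiM {..<p} (\<lambda>_. lborel)) (PiM {..<p} (\<lambda>_. lborel))"
  by (rule measurable_restrict) simp

text \<open>Change of variables for a triangular affine map. The last coordinate influences only the
  last component, so the innermost integral is a one-dimensional affine substitution with factor
  \<open>W p p\<close>; what remains is the same claim for the partial integral \<open>g\<close>,
  which is why \<open>f\<close> is arbitrary in the induction.\<close>

lemma nn_integral_triangular:
  fixes W :: "nat \<Rightarrow> nat \<Rightarrow> real"
  assumes pos: "\<And>j. j < p \<Longrightarrow> 0 < W j j" and tri: "\<And>j l. j < l \<Longrightarrow> W j l = 0"
    and f: "f \<in> borel_measurable (PiM {..<p} (\<lambda>_. lborel))"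
  shows "ennreal (\<Prod>j<p. W j j) * (\<integral>\<^sup>+x. f (\<lambda>j\<in>{..<p}. whiten W p mu x j) \<partial>PiM {..<p} (\<lambda>_. lborel))
         = (\<integral>\<^sup>+x. f x \<partial>PiM {..<p} (\<lambda>_. lborel))"
  using pos f
proof (induction p arbitrary: f)
  case 0
  interpret product_sigma_finite "\<lambda>_::nat. lborel :: real measure" ..
  show ?case by (simp add: PiM_empty nn_integral_count_space_finite restrict_def)
next
  case (Suc p)
  interpret product_sigma_finite "\<lambda>_::nat. lborel :: real measure" ..
  let ?L = "\<lambda>p. PiM {..<p} (\<lambda>_::nat. lborel :: real measure)"
  let ?T = "\<lambda>p x. \<lambda>j\<in>{..<p}. whiten W p mu x j"
  define w where "w = W p p"
  have w: "w > 0" using Suc.prems(1) by (simp add: w_def)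
  have f[measurable]: "f \<in> borel_measurable (PiM (insert p {..<p}) (\<lambda>_. lborel))"
    using Suc.prems(2) by (simp add: lessThan_Suc)
  define g where "g x = (\<integral>\<^sup>+y. f (x(p := y)) \<partial>lborel)" for x
  have fp: "(\<lambda>(x, y). f (x(p := y))) \<in> borel_measurable (?L p \<Otimes>\<^sub>M lborel)"
    using measurable_compose[OF measurable_add_dim f] by (simp add: case_prod_beta')
  have g[measurable]: "g \<in> borel_measurable (?L p)"
    unfolding g_def using fp by (rule lborel.borel_measurable_nn_integral)
  \<comment> \<open>The part of the last component that is constant in the new coordinate
    \<open>y\<close>.\<close>
  define r where "r x = whiten W p mu x p - w * mu p" for x
  \<comment> \<open>Triangularity enters here: the components below \<open>p\<close> do not see
    \<open>y\<close>.\<close>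
  have T: "?T (Suc p) (x(p := y)) = (?T p x)(p := r x + w * y)" for x y
  proof
    fix j
    show "?T (Suc p) (x(p := y)) j = ((?T p x)(p := r x + w * y)) j"
      by (cases "j < p"; cases "j = p")
        (auto simp: whiten_def tri r_def w_def right_diff_distrib less_Suc_eq intro!: sum.cong)
  qed
  have inner: "(\<integral>\<^sup>+y. f (?T (Suc p) (x(p := y))) \<partial>lborel) = ennreal (1 / w) * g (?T p x)" 
    if x: "x \<in> space (?L p)" for x
  proof -
    have Tx: "?T p x \<in> space (?L p)" by (simp add: space_PiM)
    have m: "(\<lambda>y. f ((?T p x)(p := y))) \<in> borel_measurable borel"
      using measurable_compose[OF measurable_Pair1'[OF Tx] fp] by simp
    have "g (?T p x) = ennreal w * (\<integral>\<^sup>+y. f ((?T p x)(p := r x + w * y)) \<partial>lborel)"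
      unfolding g_def using nn_integral_real_affine[OF m, of w "r x"] w by simp
    then have "ennreal (1 / w) * g (?T p x)
        = ennreal (1 / w) * ennreal w * (\<integral>\<^sup>+y. f ((?T p x)(p := r x + w * y)) \<partial>lborel)"
      by (simp add: mult.assoc)
    also have "ennreal (1 / w) * ennreal w = 1"
      using w by (subst ennreal_mult[symmetric]) auto
    finally show ?thesis unfolding T by (simp only: mult_1)
  qed
  have gT: "(\<lambda>x. g (?T p x)) \<in> borel_measurable (?L p)"
    using measurable_compose[OF measurable_restrict_whiten g] .
  have "(\<lambda>x. f (?T (Suc p) x)) \<in> borel_measurable (?L (Suc p))"
    by (rule measurable_compose[OF measurable_restrict_whiten Suc.prems(2)])
  moreover have L: "?L (Suc p) = PiM (insert p {..<p}) (\<lambda>_. lborel)"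
    by (simp only: lessThan_Suc)
  ultimately have fT: "(\<lambda>x. f (?T (Suc p) x)) \<in> borel_measurable (PiM (insert p {..<p}) (\<lambda>_. lborel))"
    by (simp only:)
  have "(\<integral>\<^sup>+x. f (?T (Suc p) x) \<partial>?L (Suc p)) = (\<integral>\<^sup>+x. \<integral>\<^sup>+y. f (?T (Suc p) (x(p := y))) \<partial>lborel \<partial>?L p)"
    unfolding L by (rule product_nn_integral_insert[OF _ _ fT]) auto
  also have "\<dots> = (\<integral>\<^sup>+x. ennreal (1 / w) * g (?T p x) \<partial>?L p)"
    by (intro nn_integral_cong inner)
  also have "\<dots> = ennreal (1 / w) * (\<integral>\<^sup>+x. g (?T p x) \<partial>?L p)"
    by (rule nn_integral_cmult[OF gT])
  finally have "ennreal (\<Prod>j<Suc p. W j j) * (\<integral>\<^sup>+x. f (?T (Suc p) x) \<partial>?L (Suc p))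
      = ennreal ((\<Prod>j<p. W j j) * w) * ennreal (1 / w) * (\<integral>\<^sup>+x. g (?T p x) \<partial>?L p)"
    by (simp add: w_def mult.assoc)
  also have "ennreal ((\<Prod>j<p. W j j) * w) * ennreal (1 / w) = ennreal (\<Prod>j<p. W j j)"
    using w prod_nonneg[of "{..<p}" "\<lambda>j. W j j"] Suc.prems(1)
    by (subst ennreal_mult[symmetric]) (auto simp: less_imp_le)
  also have "\<dots> * (\<integral>\<^sup>+x. g (?T p x) \<partial>?L p) = (\<integral>\<^sup>+x. g x \<partial>?L p)"
    by (rule Suc.IH[OF _ g]) (use Suc.prems(1) in auto)
  also have "\<dots> = (\<integral>\<^sup>+x. f x \<partial>?L (Suc p))"
    unfolding g_def using product_nn_integral_insert[OF _ _ f] by (simp add: lessThan_Suc)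
  finally show ?case .
qed

lemma sets_gauss [simp, measurable_cong]: "sets (gauss p mu S) = sets (PiM {..<p} (\<lambda>_. lborel))"
  by (simp add: gauss_def)

lemma space_gauss [simp]: "space (gauss p mu S) = space (PiM {..<p} (\<lambda>_. lborel))"
  by (simp add: gauss_def)

text \<open>The exponent is a sum of squares of whitened coordinates, and \<open>det S\<close> is
  the inverse square of the diagonal product, so the density factors up to the Jacobian.\<close>

lemma gauss_density_whiten:
  fixes W :: "nat \<Rightarrow> nat \<Rightarrow> real"
  assumes pos: "\<And>j. j < p \<Longrightarrow> 0 < W j j"
    and q: "\<And>a b. qform p S a b = (\<Sum>j<p. (\<Sum>l<p. W j l * a l) * (\<Sum>l<p. W j l * b l))"
    and det: "det S * (\<Prod>j<p. W j j)\<^sup>2 = 1"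
  shows "gauss_density p mu S x = (\<Prod>j<p. W j j) * (\<Prod>j<p. std_normal_density (whiten W p mu x j))"
proof -
  define d where "d = (\<Prod>j<p. W j j)"
  have d: "d > 0" unfolding d_def using pos by (intro prod_pos) auto
  have "det S * d\<^sup>2 = 1" using det by (simp add: d_def)
  then have "det S = 1 / d\<^sup>2" using d by (simp add: eq_divide_eq)
  then have "sqrt ((2 * pi) ^ p * det S) = sqrt (2 * pi) ^ p / d"
    using d by (simp add: real_sqrt_divide real_sqrt_power real_sqrt_mult power_mult_distrib)
  moreover have "(\<Prod>j<p. std_normal_density (whiten W p mu x j))
      = exp (- eta p S x mu / 2) / sqrt (2 * pi) ^ p"
    unfolding std_normal_density_def eta_def q
    by (simp add: prod_dividef flip: exp_sum)
       (simp add: whiten_def power2_eq_square sum_negf sum_divide_distrib)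
  ultimately show ?thesis
    using d by (simp add: gauss_density_def d_def)
qed

text \<open>The diagonal product in the density is exactly the Jacobian consumed by the
  substitution, which leaves a product of standard normal integrals. Boxes suffice because they
  determine a finite product of probability measures.\<close>

lemma emeasure_gauss_whitened_box:
  fixes W :: "nat \<Rightarrow> nat \<Rightarrow> real"
  assumes pos: "\<And>j. j < p \<Longrightarrow> 0 < W j j" and tri: "\<And>j l. j < l \<Longrightarrow> W j l = 0"
    and q: "\<And>a b. qform p S a b = (\<Sum>j<p. (\<Sum>l<p. W j l * a l) * (\<Sum>l<p. W j l * b l))"
    and det: "det S * (\<Prod>j<p. W j j)\<^sup>2 = 1"
    and A: "\<And>j. j < p \<Longrightarrow> A j \<in> sets borel"
  shows "{x \<in> space (PiM {..<p} (\<lambda>_. lborel)). \<forall>j<p. whiten W p mu x j \<in> A j} \<in> sets (gauss p mu S)" (is "?B \<in> _")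
    and "emeasure (gauss p mu S) {x \<in> space (PiM {..<p} (\<lambda>_. lborel)). \<forall>j<p. whiten W p mu x j \<in> A j}
       = (\<Prod>j<p. emeasure std_gauss (A j))"
proof -
  interpret product_sigma_finite "\<lambda>_::nat. lborel :: real measure" ..
  let ?L = "PiM {..<p} (\<lambda>_::nat. lborel :: real measure)"
  define f where "f y = (\<Prod>j<p. ennreal (std_normal_density (y j)) * indicator (A j) (y j))" for y :: "nat \<Rightarrow> real"
  have [measurable]: "A j \<in> sets borel" if "j \<in> {..<p}" for j using A that by simp
  have f: "f \<in> borel_measurable ?L" unfolding f_def by measurable
  have "{x \<in> space ?L. \<forall>j\<in>{..<p}. whiten W p mu x j \<in> A j} \<in> sets ?L"
    by measurable
  then show B: "?B \<in> sets (gauss p mu S)" by (simp add: Ball_def)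
  have gd: "gauss_density p mu S x = (\<Prod>j<p. W j j) * (\<Prod>j<p. std_normal_density (whiten W p mu x j))" for x
    by (rule gauss_density_whiten[OF pos q det])
  have gm: "(\<lambda>x. gauss_density p mu S x) \<in> borel_measurable ?L"
    unfolding gd by measurable
  have W0: "(\<Prod>j<p. W j j) \<ge> 0" using pos by (intro prod_nonneg) (auto intro: less_imp_le)
  have "emeasure (gauss p mu S) ?B = (\<integral>\<^sup>+x. ennreal (gauss_density p mu S x) * indicator ?B x \<partial>?L)"
    using B gm unfolding gauss_def by (subst emeasure_density) auto
  also have "\<dots> = (\<integral>\<^sup>+x. ennreal (\<Prod>j<p. W j j) * f (\<lambda>j\<in>{..<p}. whiten W p mu x j) \<partial>?L)"
  proof (rule nn_integral_cong)
    fix x assume x: "x \<in> space ?L"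
    have "f (\<lambda>j\<in>{..<p}. whiten W p mu x j)
       = (\<Prod>j<p. ennreal (std_normal_density (whiten W p mu x j))) * (\<Prod>j<p. indicator (A j) (whiten W p mu x j))"
      unfolding f_def prod.distrib by simp
    also have "(\<Prod>j<p. indicator (A j) (whiten W p mu x j)) = (indicator ?B x :: ennreal)"
    proof (cases "x \<in> ?B")
      case False
      with x obtain j where "j < p" "whiten W p mu x j \<notin> A j" by auto
      then have "(\<Prod>j<p. indicator (A j) (whiten W p mu x j)) = (0::ennreal)"
        by (intro prod_zero) (auto intro!: bexI[of _ j])
      with False show ?thesis by simp
    qed (use x in auto)
    also have "(\<Prod>j<p. ennreal (std_normal_density (whiten W p mu x j)))
       = ennreal (\<Prod>j<p. std_normal_density (whiten W p mu x j))"
      by (rule prod_ennreal) simp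
    finally have fx: "f (\<lambda>j\<in>{..<p}. whiten W p mu x j)
       = ennreal (\<Prod>j<p. std_normal_density (whiten W p mu x j)) * indicator ?B x" .
    show "ennreal (gauss_density p mu S x) * indicator ?B x
       = ennreal (\<Prod>j<p. W j j) * f (\<lambda>j\<in>{..<p}. whiten W p mu x j)"
      unfolding gd fx using W0 by (simp add: ennreal_mult prod_nonneg mult.assoc)
  qed
  also have "\<dots> = ennreal (\<Prod>j<p. W j j) * (\<integral>\<^sup>+x. f (\<lambda>j\<in>{..<p}. whiten W p mu x j) \<partial>?L)"
    by (rule nn_integral_cmult) (rule measurable_compose[OF measurable_restrict_whiten f])
  also have "\<dots> = (\<integral>\<^sup>+x. f x \<partial>?L)"
    by (rule nn_integral_triangular[OF pos tri f])
  also have "\<dots> = (\<Prod>j<p. \<integral>\<^sup>+y. ennreal (std_normal_density y) * indicator (A j) y \<partial>lborel)"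
    unfolding f_def by (rule product_nn_integral_prod) auto
  also have "\<dots> = (\<Prod>j<p. emeasure std_gauss (A j))"
    using A by (intro prod.cong refl) (simp add: emeasure_density)
  finally show "emeasure (gauss p mu S) ?B = (\<Prod>j<p. emeasure std_gauss (A j))" .
qed

lemma prob_space_std_gauss: "prob_space std_gauss"
  by (rule prob_space_normal_density) simp

text \<open>The whole space is the whitened box with all sides \<open>UNIV\<close>.\<close>

lemma prob_space_gauss:
  assumes "spd p S"
  shows "prob_space (gauss p mu S)"
proof -
  obtain W where W: "\<And>j. j < p \<Longrightarrow> 0 < W j j" "\<And>j l. j < l \<Longrightarrow> W j l = 0"
    "\<And>a b. qform p S a b = (\<Sum>j<p. (\<Sum>l<p. W j l * a l) * (\<Sum>l<p. W j l * b l))"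
    "det S * (\<Prod>j<p. W j j)\<^sup>2 = 1"
    by (rule whitening_exists[OF assms]) blast
  interpret N: prob_space std_gauss by (rule prob_space_std_gauss)
  have "emeasure (gauss p mu S) (space (gauss p mu S)) = 1"
    using emeasure_gauss_whitened_box(2)[OF W, of "\<lambda>_. UNIV" mu] N.emeasure_space_1 by simp
  then show ?thesis by (rule prob_spaceI)
qed

section \<open>The whitened sample\<close>

text \<open>A numeric class index replaces \<open>fst\<close> and \<open>snd\<close>, so that both
  classes can be treated by one argument and their coordinates put into one indexed family.\<close>

definition class_data :: "nat \<Rightarrow> 'a \<times> 'a \<Rightarrow> 'a" where
  "class_data i s = (if i = 0 then fst s else snd s)"

text \<open>In an index \<open>(i, k, j)\<close>, \<open>i\<close> is the class, \<open>k\<close> the observation and \<open>j\<close> the coordinate.\<close>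

definition whitened_coord :: "(nat \<Rightarrow> nat \<Rightarrow> real) \<Rightarrow> nat \<Rightarrow> (nat \<Rightarrow> nat \<Rightarrow> real) \<Rightarrow> nat \<times> nat \<times> nat
    \<Rightarrow> (nat \<Rightarrow> nat \<Rightarrow> real) \<times> (nat \<Rightarrow> nat \<Rightarrow> real) \<Rightarrow> real" where
  "whitened_coord W p mu = (\<lambda>(i, k, j) s. whiten W p (mu i) (class_data i s k) j)"

lemma prob_space_sample_distr:
  assumes "spd p S"
  shows "prob_space (sample_distr p n0 n1 mu0 mu1 S)"
proof -
  interpret P0: prob_space "PiM {..<n0} (\<lambda>_. gauss p mu0 S)"
    by (intro prob_space_PiM prob_space_gauss assms)
  interpret P1: prob_space "PiM {..<n1} (\<lambda>_. gauss p mu1 S)"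
    by (intro prob_space_PiM prob_space_gauss assms)
  interpret pair_prob_space "PiM {..<n0} (\<lambda>_. gauss p mu0 S)" "PiM {..<n1} (\<lambda>_. gauss p mu1 S)" ..
  show ?thesis unfolding sample_distr_def by unfold_locales
qed

lemma borel_measurable_class_data:
  fixes n :: "nat \<Rightarrow> nat" and mu :: "nat \<Rightarrow> nat \<Rightarrow> real"
  assumes "i \<in> {0, 1}" "k < n i" "l < p"
  shows "(\<lambda>s. class_data i s k l) \<in> borel_measurable (sample_distr p (n 0) (n 1) (mu 0) (mu 1) S)"
proof -
  have 1: "(\<lambda>x. x l) \<in> measurable (gauss p m S) lborel" for m
    using assms(3) by (simp add: measurable_component_singleton cong: measurable_cong_sets)
  have 2: "(\<lambda>x. x k l) \<in> measurable (PiM {..<n i} (\<lambda>_. gauss p (mu i) S)) lborel"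
    by (rule measurable_compose[OF measurable_component_singleton[of k] 1]) (use assms(2) in auto)
  show ?thesis
    unfolding sample_distr_def class_data_def
    using assms(1) measurable_compose[OF measurable_fst 2] measurable_compose[OF measurable_snd 2]
    by auto
qed

lemma borel_measurable_whitened_coord:
  assumes "i \<in> {0, 1}" "k < n i"
  shows "whitened_coord W p mu (i, k, j) \<in> borel_measurable (sample_distr p (n 0) (n 1) (mu 0) (mu 1) S)"
  unfolding whitened_coord_def whiten_def prod.case
  by (intro borel_measurable_sum borel_measurable_times borel_measurable_const borel_measurable_diff
      borel_measurable_class_data assms) auto

text \<open>The joint law over the flat index set of class, observation and coordinate yields
  independence of all coordinates at once. It is identified on boxes, where the measure factors by
  class, then by observation, then by coordinate, and the nested products reassemble into a product
  over \<open>I\<close>.\<close>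

lemma distr_whitened_sample:
  fixes W :: "nat \<Rightarrow> nat \<Rightarrow> real" and n :: "nat \<Rightarrow> nat" and mu :: "nat \<Rightarrow> nat \<Rightarrow> real"
  assumes spd: "spd p S"
    and W: "\<And>j. j < p \<Longrightarrow> 0 < W j j" "\<And>j l. j < l \<Longrightarrow> W j l = 0"
      "\<And>a b. qform p S a b = (\<Sum>j<p. (\<Sum>l<p. W j l * a l) * (\<Sum>l<p. W j l * b l))"
      "det S * (\<Prod>j<p. W j j)\<^sup>2 = 1"
  defines "I \<equiv> Sigma {0, 1} (\<lambda>i. {..<n i} \<times> {..<p})"
  shows "distr (sample_distr p (n 0) (n 1) (mu 0) (mu 1) S) (PiM I (\<lambda>_. borel))
           (\<lambda>s. \<lambda>t\<in>I. whitened_coord W p mu t s) = PiM I (\<lambda>_. std_gauss)"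
    (is "distr ?M _ ?X = _")
proof -
  interpret N: prob_space std_gauss by (rule prob_space_std_gauss)
  interpret product_sigma_finite "\<lambda>_::nat \<times> nat \<times> nat. std_gauss" ..
  let ?P = "\<lambda>i. PiM {..<n i} (\<lambda>_. gauss p (mu i) S)"
  interpret G: prob_space "gauss p m S" for m by (rule prob_space_gauss[OF spd])
  interpret GP: product_sigma_finite "\<lambda>_::nat. gauss p (mu i) S" for i ..
  interpret P: prob_space "?P i" for i by (intro prob_space_PiM G.prob_space_axioms)
  have X: "?X \<in> measurable ?M (PiM I (\<lambda>_. borel))"
  proof (rule measurable_restrict)
    fix t assume "t \<in> I"
    then obtain i k j where t: "t = (i, k, j)" "i \<in> {0, 1}" "k < n i" by (auto simp: I_def)
    show "whitened_coord W p mu t \<in> borel_measurable ?M"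
      unfolding t(1) using t(2,3) by (rule borel_measurable_whitened_coord)
  qed
  show ?thesis
  proof (rule PiM_eqI)
    show "finite I" by (auto simp: I_def)
    show "sets (distr ?M (PiM I (\<lambda>_. borel)) ?X) = sets (PiM I (\<lambda>_. std_gauss))"
      by (auto intro!: sets_PiM_cong)
    fix A assume "\<And>t. t \<in> I \<Longrightarrow> A t \<in> sets std_gauss"
    then have A: "A (i, k, j) \<in> sets borel" if "i \<in> {0, 1}" "k < n i" "j < p" for i k j
      using that by (auto simp: I_def)
    define B where "B i k = {x \<in> space (PiM {..<p} (\<lambda>_. lborel)). \<forall>j<p. whiten W p (mu i) x j \<in> A (i, k, j)}" for i k
    have B: "B i k \<in> sets (gauss p (mu i) S)" 
         "emeasure (gauss p (mu i) S) (B i k) = (\<Prod>j<p. emeasure std_gauss (A (i, k, j)))"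
      if "i \<in> {0, 1}" "k < n i" for i k
      unfolding B_def using emeasure_gauss_whitened_box[OF W, of "\<lambda>j. A (i, k, j)" "mu i"] A[OF that] by auto
    have PB: "PiE {..<n i} (B i) \<in> sets (?P i)" if "i \<in> {0, 1}" for i
      using B(1) that by (intro sets_PiM_I_finite) auto
    have PB_iff: "a \<in> PiE {..<n i} (B i) \<longleftrightarrow> a \<in> space (?P i) \<and>
        (\<forall>k<n i. \<forall>j<p. whiten W p (mu i) (a k) j \<in> A (i, k, j))" for a i
      unfolding space_PiM[of "{..<n i}"] space_gauss PiE_iff B_def by auto
    \<comment> \<open>The preimage of a box is a rectangle over the two classes, each side of which
      is a box over the observations.\<close>
    have "(a, b) \<in> ?X -` PiE I A \<inter> space ?M \<longleftrightarrow> (a, b) \<in> PiE {..<n 0} (B 0) \<times> PiE {..<n 1} (B 1)" for a b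
    proof -
      have "(\<forall>t\<in>I. whitened_coord W p mu t (a, b) \<in> A t) \<longleftrightarrow>
          (\<forall>k<n 0. \<forall>j<p. whiten W p (mu 0) (a k) j \<in> A (0, k, j)) \<and>
          (\<forall>k<n 1. \<forall>j<p. whiten W p (mu 1) (b k) j \<in> A (1, k, j))"
        by (simp add: I_def whitened_coord_def class_data_def Ball_def) blast
      then show ?thesis
        unfolding mem_Times_iff PB_iff fst_conv snd_conv Int_iff vimage_eq restrict_PiE_iff
          sample_distr_def space_pair_measure by blast
    qed
    then have "?X -` PiE I A \<inter> space ?M = PiE {..<n 0} (B 0) \<times> PiE {..<n 1} (B 1)"
      unfolding set_eq_iff split_paired_All by blast
    moreover have "PiE I A \<in> sets (PiM I (\<lambda>_. borel))"
      using A by (intro sets_PiM_I_finite) (auto simp: I_def)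
    ultimately have "emeasure (distr ?M (PiM I (\<lambda>_. borel)) ?X) (PiE I A)
        = emeasure (?P 0 \<Otimes>\<^sub>M ?P 1) (PiE {..<n 0} (B 0) \<times> PiE {..<n 1} (B 1))"
      using emeasure_distr[OF X, of "PiE I A"] by (simp add: sample_distr_def)
    also have "\<dots> = emeasure (?P 0) (PiE {..<n 0} (B 0)) * emeasure (?P 1) (PiE {..<n 1} (B 1))"
      by (rule P.emeasure_pair_measure_Times[OF PB PB]) auto
    also have "\<dots> = (\<Prod>i\<in>{0, 1}. emeasure (?P i) (PiE {..<n i} (B i)))"
      by simp
    also have "\<dots> = (\<Prod>i\<in>{0, 1}. \<Prod>k<n i. \<Prod>j<p. emeasure std_gauss (A (i, k, j)))"
    proof (rule prod.cong[OF refl])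
      fix i :: nat assume i: "i \<in> {0, 1}"
      have "emeasure (?P i) (PiE {..<n i} (B i)) = (\<Prod>k<n i. emeasure (gauss p (mu i) S) (B i k))"
        using B(1)[OF i] by (intro GP.emeasure_PiM) auto
      then show "emeasure (?P i) (PiE {..<n i} (B i)) = (\<Prod>k<n i. \<Prod>j<p. emeasure std_gauss (A (i, k, j)))"
        using B(2)[OF i] by simp
    qed
    also have "\<dots> = (\<Prod>i\<in>{0, 1}. \<Prod>t\<in>{..<n i} \<times> {..<p}. emeasure std_gauss (A (i, t)))"
      unfolding prod.cartesian_product by (intro prod.cong refl) auto
    also have "\<dots> = (\<Prod>(i, t)\<in>I. emeasure std_gauss (A (i, t)))"
      unfolding I_def by (rule prod.Sigma) auto
    also have "\<dots> = (\<Prod>t\<in>I. emeasure std_gauss (A t))"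
      by (intro prod.cong refl) auto
    finally show "emeasure (distr ?M (PiM I (\<lambda>_. borel)) ?X) (PiE I A) = (\<Prod>t\<in>I. emeasure std_gauss (A t))" .
  qed
qed

section \<open>Second moments\<close>

context prob_space
begin

text \<open>Centred independent variables are orthogonal, so only the diagonal of the double sum
  survives. Integrability accompanies the value because Markov's inequality asks for it.\<close>

lemma second_moment_sum_indep:
  fixes Y :: "'i \<Rightarrow> 'a \<Rightarrow> real"
  assumes fin: "finite J" and indep: "indep_vars (\<lambda>_. borel) Y J"
    and sq: "\<And>j. j \<in> J \<Longrightarrow> integrable M (\<lambda>x. (Y j x)\<^sup>2)"
    and zero: "\<And>j. j \<in> J \<Longrightarrow> expectation (Y j) = 0"
  shows "integrable M (\<lambda>x. (\<Sum>j\<in>J. Y j x)\<^sup>2)"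
    and "expectation (\<lambda>x. (\<Sum>j\<in>J. Y j x)\<^sup>2) = (\<Sum>j\<in>J. expectation (\<lambda>x. (Y j x)\<^sup>2))"
proof -
  have meas: "random_variable borel (Y j)" if "j \<in> J" for j
    using indep that by (auto simp: indep_vars_def)
  have int: "integrable M (Y j)" if "j \<in> J" for j
    using square_integrable_imp_integrable[OF meas sq] that by blast
  have *: "integrable M (\<lambda>x. Y i x * Y j x) \<and>
      expectation (\<lambda>x. Y i x * Y j x) = (if i = j then expectation (\<lambda>x. (Y j x)\<^sup>2) else 0)"
    if ij: "i \<in> J" "j \<in> J" for i j
  proof (cases "i = j")
    case True
    then show ?thesis using sq[OF ij(1)] by (simp add: power2_eq_square)
  next
    case False
    have "indep_vars (\<lambda>_. borel) Y {i, j}"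
      by (rule indep_vars_subset[OF indep]) (use ij in auto)
    note I = this
    have "integrable M (\<lambda>x. \<Prod>k\<in>{i, j}. Y k x)"
      by (rule indep_vars_integrable[OF _ I]) (use ij int in auto)
    moreover have "expectation (\<lambda>x. \<Prod>k\<in>{i, j}. Y k x) = (\<Prod>k\<in>{i, j}. expectation (Y k))"
      by (rule indep_vars_lebesgue_integral[OF _ I]) (use ij int in auto)
    ultimately show ?thesis using False zero ij by simp
  qed
  have eq: "(\<lambda>x. (\<Sum>j\<in>J. Y j x)\<^sup>2) = (\<lambda>x. \<Sum>i\<in>J. \<Sum>j\<in>J. Y i x * Y j x)"
    by (simp add: power2_eq_square sum_product)
  show "integrable M (\<lambda>x. (\<Sum>j\<in>J. Y j x)\<^sup>2)"
    unfolding eq using * by (intro Bochner_Integration.integrable_sum) auto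
  have "expectation (\<lambda>x. (\<Sum>j\<in>J. Y j x)\<^sup>2) = (\<Sum>i\<in>J. \<Sum>j\<in>J. expectation (\<lambda>x. Y i x * Y j x))"
    unfolding eq using * by (simp add: Bochner_Integration.integral_sum Bochner_Integration.integrable_sum)
  also have "\<dots> = (\<Sum>i\<in>J. \<Sum>j\<in>J. if i = j then expectation (\<lambda>x. (Y j x)\<^sup>2) else 0)"
    using * by (intro sum.cong) auto
  also have "\<dots> = (\<Sum>j\<in>J. expectation (\<lambda>x. (Y j x)\<^sup>2))"
    using fin by simp
  finally show "expectation (\<lambda>x. (\<Sum>j\<in>J. Y j x)\<^sup>2) = (\<Sum>j\<in>J. expectation (\<lambda>x. (Y j x)\<^sup>2))" .
qed

text \<open>The fourth moment is there for the variance of the square,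
  \<open>3 * \<sigma> ^ 4 - \<sigma> ^ 4 = 2 * \<sigma> ^ 4\<close>.\<close>

lemma centered_normal_moments:
  fixes X :: "'a \<Rightarrow> real"
  assumes X: "distributed M lborel X (normal_density 0 \<sigma>)" and \<sigma>: "0 < \<sigma>"
  shows "integrable M (\<lambda>x. X x ^ k)"
    and "expectation X = 0" and "expectation (\<lambda>x. (X x)\<^sup>2) = \<sigma>\<^sup>2" and "expectation (\<lambda>x. X x ^ 4) = 3 * \<sigma> ^ 4"
proof -
  show "integrable M (\<lambda>x. X x ^ k)"
    using integrable_normal_moment[OF \<sigma>, of 0 k]
    by (subst distributed_integrable[OF X, symmetric]) auto
  show "expectation X = 0"
    by (rule normal_distributed_expectation[OF \<sigma> X])
  \<comment> \<open>General even moment; \<open>k = 1\<close> gives the variance and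
    \<open>k = 2\<close> the constant 3 as \<open>24 / (4 * 2)\<close>.\<close>
  have E: "expectation (\<lambda>x. X x ^ (2 * k)) = fact (2 * k) / ((2 / \<sigma>\<^sup>2) ^ k * fact k)" for k
    using integral_normal_moment_even[OF \<sigma>, of 0 k]
    by (subst distributed_integral[OF X, symmetric]) auto
  show "expectation (\<lambda>x. (X x)\<^sup>2) = \<sigma>\<^sup>2"
    using E[of 1] by simp
  show "expectation (\<lambda>x. X x ^ 4) = 3 * \<sigma> ^ 4"
    using E[of 2] by (simp add: fact_numeral power_divide)
qed

section \<open>Quadratic and linear forms in independent centred normal coordinates\<close>

context
  fixes h :: "nat \<times> nat \<Rightarrow> 'a \<Rightarrow> real" and \<sigma> :: "nat \<Rightarrow> real" and p :: nat
  assumes indep: "indep_vars (\<lambda>_. borel) h ({0, 1} \<times> {..<p})"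
    and pos: "\<And>i. i \<in> {0, 1} \<Longrightarrow> 0 < \<sigma> i"
    and normal: "\<And>i j. i \<in> {0, 1} \<Longrightarrow> j < p \<Longrightarrow> distributed M lborel (h (i, j)) (normal_density 0 (\<sigma> i))"
begin

lemma indep_row:
  assumes "i \<in> {0, 1}"
  shows "indep_vars (\<lambda>_. borel) (\<lambda>j. h (i, j)) {..<p}"
proof -
  have "indep_vars (\<lambda>j. PiM {(i, j)} (\<lambda>_. borel)) (\<lambda>j x. restrict (\<lambda>t. h t x) {(i, j)}) {..<p}"
    by (rule indep_vars_restrict[OF indep]) (use assms in \<open>auto simp: disjoint_family_on_def\<close>)
  from indep_vars_compose2[OF this, of "\<lambda>j f. f (i, j)" "\<lambda>_. borel"]
  show ?thesis by (simp add: measurable_component_singleton)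
qed

text \<open>Serves the product of a fixed vector with the noise; \<open>c\<close> will be the
  whitened fixed vector.\<close>

lemma second_moment_linear:
  fixes c :: "nat \<Rightarrow> real"
  assumes i: "i \<in> {0, 1}"
  shows "integrable M (\<lambda>x. (\<Sum>j<p. c j * h (i, j) x)\<^sup>2)"
    and "expectation (\<lambda>x. (\<Sum>j<p. c j * h (i, j) x)\<^sup>2) = (\<Sum>j<p. c j * c j) * (\<sigma> i)\<^sup>2"
proof -
  note mom = centered_normal_moments[OF normal[OF i] pos[OF i]]
  have I: "indep_vars (\<lambda>_. borel) (\<lambda>j x. c j * h (i, j) x) {..<p}"
    by (rule indep_vars_compose2[OF indep_row[OF i]]) simp
  note S = second_moment_sum_indep[OF finite_lessThan I]
  show "integrable M (\<lambda>x. (\<Sum>j<p. c j * h (i, j) x)\<^sup>2)"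
    by (rule S(1)) (use mom in \<open>auto simp: power_mult_distrib\<close>)
  have "expectation (\<lambda>x. (\<Sum>j<p. c j * h (i, j) x)\<^sup>2) = (\<Sum>j<p. expectation (\<lambda>x. (c j * h (i, j) x)\<^sup>2))"
    by (rule S(2)) (use mom in \<open>auto simp: power_mult_distrib\<close>)
  then show "expectation (\<lambda>x. (\<Sum>j<p. c j * h (i, j) x)\<^sup>2) = (\<Sum>j<p. c j * c j) * (\<sigma> i)\<^sup>2"
    by (simp add: power_mult_distrib mom(3) sum_distrib_right) (simp add: power2_eq_square)
qed

text \<open>The sum is \<open>(\<sigma> i)^2\<close> times a chi-square variable with
  \<open>p\<close> degrees of freedom. Centring each square makes the summands independent with mean
  zero, each of second moment \<open>2 * \<sigma> i ^ 4\<close>.\<close>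

lemma second_moment_chi_square:
  assumes i: "i \<in> {0, 1}"
  shows "integrable M (\<lambda>x. ((\<Sum>j<p. h (i, j) x * h (i, j) x) - real p * (\<sigma> i)\<^sup>2)\<^sup>2)"
    and "expectation (\<lambda>x. ((\<Sum>j<p. h (i, j) x * h (i, j) x) - real p * (\<sigma> i)\<^sup>2)\<^sup>2) = 2 * real p * (\<sigma> i) ^ 4"
proof -
  note mom = centered_normal_moments[OF normal[OF i] pos[OF i]]
  have I: "indep_vars (\<lambda>_. borel) (\<lambda>j x. (h (i, j) x)\<^sup>2 - (\<sigma> i)\<^sup>2) {..<p}"
    by (rule indep_vars_compose2[OF indep_row[OF i]]) simp
  note S = second_moment_sum_indep[OF finite_lessThan I]
  have eq: "((h (i, j) x)\<^sup>2 - (\<sigma> i)\<^sup>2)\<^sup>2 = h (i, j) x ^ 4 - 2 * (\<sigma> i)\<^sup>2 * (h (i, j) x)\<^sup>2 + \<sigma> i ^ 4" for j x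
    by (simp add: power2_eq_square power4_eq_xxxx algebra_simps)
  have sum: "(\<Sum>j<p. h (i, j) x * h (i, j) x) - real p * (\<sigma> i)\<^sup>2 = (\<Sum>j<p. (h (i, j) x)\<^sup>2 - (\<sigma> i)\<^sup>2)" for x
    by (simp add: sum_subtractf power2_eq_square)
  have sq: "integrable M (\<lambda>x. ((h (i, j) x)\<^sup>2 - (\<sigma> i)\<^sup>2)\<^sup>2)"
    and ex: "expectation (\<lambda>x. ((h (i, j) x)\<^sup>2 - (\<sigma> i)\<^sup>2)\<^sup>2) = 2 * \<sigma> i ^ 4"
    and zero: "expectation (\<lambda>x. (h (i, j) x)\<^sup>2 - (\<sigma> i)\<^sup>2) = 0" if "j < p" for j
  proof -
    note [simp] = mom[OF that]
    show "integrable M (\<lambda>x. ((h (i, j) x)\<^sup>2 - (\<sigma> i)\<^sup>2)\<^sup>2)" unfolding eq by simp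
    show "expectation (\<lambda>x. ((h (i, j) x)\<^sup>2 - (\<sigma> i)\<^sup>2)\<^sup>2) = 2 * \<sigma> i ^ 4"
      unfolding eq by (simp add: prob_space)
    show "expectation (\<lambda>x. (h (i, j) x)\<^sup>2 - (\<sigma> i)\<^sup>2) = 0" by (simp add: prob_space)
  qed
  show "integrable M (\<lambda>x. ((\<Sum>j<p. h (i, j) x * h (i, j) x) - real p * (\<sigma> i)\<^sup>2)\<^sup>2)"
    unfolding sum by (rule S(1)) (use sq zero in auto)
  have "expectation (\<lambda>x. (\<Sum>j<p. (h (i, j) x)\<^sup>2 - (\<sigma> i)\<^sup>2)\<^sup>2) = (\<Sum>j<p. 2 * \<sigma> i ^ 4)"
    by (subst S(2)) (use sq zero ex in auto)
  then show "expectation (\<lambda>x. ((\<Sum>j<p. h (i, j) x * h (i, j) x) - real p * (\<sigma> i)\<^sup>2)\<^sup>2) = 2 * real p * (\<sigma> i) ^ 4"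
    unfolding sum by simp
qed

text \<open>The products over \<open>j\<close> live on the disjoint blocks
  \<open>{(0, j), (1, j)}\<close> and are therefore independent; each is centred because its two
  factors are.\<close>

lemma second_moment_cross:
  shows "integrable M (\<lambda>x. (\<Sum>j<p. h (0, j) x * h (1, j) x)\<^sup>2)"
    and "expectation (\<lambda>x. (\<Sum>j<p. h (0, j) x * h (1, j) x)\<^sup>2) = real p * (\<sigma> 0)\<^sup>2 * (\<sigma> 1)\<^sup>2"
proof -
  have "indep_vars (\<lambda>j. PiM {(0, j), (1, j)} (\<lambda>_. borel)) (\<lambda>j x. restrict (\<lambda>t. h t x) {(0, j), (1, j)}) {..<p}"
    by (rule indep_vars_restrict[OF indep]) (auto simp: disjoint_family_on_def)
  from indep_vars_compose2[OF this, of "\<lambda>j f. f (0, j) * f (1, j)" "\<lambda>_. borel"]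
  have I: "indep_vars (\<lambda>_. borel) (\<lambda>j x. h (0, j) x * h (1, j) x) {..<p}"
    by (simp add: measurable_component_singleton borel_measurable_times)
  note S = second_moment_sum_indep[OF finite_lessThan I]
  \<comment> \<open>Stated for a general power: \<open>k = 1\<close> shows that the products are
    centred, \<open>k = 2\<close> gives their second moments.\<close>
  have pair: "expectation (\<lambda>x. h (0, j) x ^ k * h (1, j) x ^ k) = expectation (\<lambda>x. h (0, j) x ^ k) * expectation (\<lambda>x. h (1, j) x ^ k)"
    "integrable M (\<lambda>x. h (0, j) x ^ k * h (1, j) x ^ k)"
    if j: "j < p" for j k
  proof -
    have "indep_vars (\<lambda>_. borel) h {(0, j), (1, j)}"
      by (rule indep_vars_subset[OF indep]) (use j in auto)
    then have J: "indep_vars (\<lambda>_. borel) (\<lambda>t x. h t x ^ k) {(0, j), (1, j)}"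
      by (rule indep_vars_compose2) simp
    have int: "integrable M (\<lambda>x. h t x ^ k)" if "t \<in> {(0, j), (1, j)}" for t
      using that centered_normal_moments(1)[OF normal pos] j by auto
    show "expectation (\<lambda>x. h (0, j) x ^ k * h (1, j) x ^ k) = expectation (\<lambda>x. h (0, j) x ^ k) * expectation (\<lambda>x. h (1, j) x ^ k)"
      using indep_vars_lebesgue_integral[OF _ J int] by simp
    show "integrable M (\<lambda>x. h (0, j) x ^ k * h (1, j) x ^ k)"
      using indep_vars_integrable[OF _ J int] by simp
  qed
  have sq: "integrable M (\<lambda>x. (h (0, j) x * h (1, j) x)\<^sup>2)"
    and ex: "expectation (\<lambda>x. (h (0, j) x * h (1, j) x)\<^sup>2) = (\<sigma> 0)\<^sup>2 * (\<sigma> 1)\<^sup>2"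
    and zero: "expectation (\<lambda>x. h (0, j) x * h (1, j) x) = 0" if j: "j < p" for j
    using pair[OF j, of 2] pair[OF j, of 1] centered_normal_moments[OF normal pos, OF _ j]
    by (auto simp: power_mult_distrib)
  show "integrable M (\<lambda>x. (\<Sum>j<p. h (0, j) x * h (1, j) x)\<^sup>2)"
    by (rule S(1)) (use sq zero in auto)
  show "expectation (\<lambda>x. (\<Sum>j<p. h (0, j) x * h (1, j) x)\<^sup>2) = real p * (\<sigma> 0)\<^sup>2 * (\<sigma> 1)\<^sup>2"
    by (subst S(2)) (use sq zero ex in auto)
qed

end

end

text \<open>Projecting the product law to one index recovers the marginal; the joint law is thus the
  product of its marginals, which is independence.\<close>

lemma whitened_coords_indep:
  fixes W :: "nat \<Rightarrow> nat \<Rightarrow> real" and n :: "nat \<Rightarrow> nat" and mu :: "nat \<Rightarrow> nat \<Rightarrow> real"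
  assumes spd: "spd p S"
    and W: "\<And>j. j < p \<Longrightarrow> 0 < W j j" "\<And>j l. j < l \<Longrightarrow> W j l = 0"
      "\<And>a b. qform p S a b = (\<Sum>j<p. (\<Sum>l<p. W j l * a l) * (\<Sum>l<p. W j l * b l))"
      "det S * (\<Prod>j<p. W j j)\<^sup>2 = 1"
    and p: "0 < p" and n: "0 < n 0"
  defines "I \<equiv> Sigma {0, 1} (\<lambda>i. {..<n i} \<times> {..<p})"
    and "M \<equiv> sample_distr p (n 0) (n 1) (mu 0) (mu 1) S"
  shows "prob_space.indep_vars M (\<lambda>_. borel) (whitened_coord W p mu) I"
    and "\<And>t. t \<in> I \<Longrightarrow> distributed M lborel (whitened_coord W p mu t) std_normal_density"
proof -
  interpret prob_space M unfolding M_def by (rule prob_space_sample_distr[OF spd])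
  interpret N: prob_space std_gauss by (rule prob_space_std_gauss)
  let ?X = "whitened_coord W p mu"
  have rv: "random_variable borel (?X t)" if "t \<in> I" for t
  proof -
    obtain i k j where t: "t = (i, k, j)" "i \<in> {0, 1}" "k < n i" using \<open>t \<in> I\<close> by (auto simp: I_def)
    show ?thesis unfolding t(1) M_def using t(2,3) by (rule borel_measurable_whitened_coord)
  qed
  have D: "distr M (PiM I (\<lambda>_. borel)) (\<lambda>s. \<lambda>t\<in>I. ?X t s) = PiM I (\<lambda>_. std_gauss)"
    unfolding M_def I_def by (rule distr_whitened_sample[OF spd W])
  have d: "distr M borel (?X t) = std_gauss" if t: "t \<in> I" for t
  proof -
    have "std_gauss = distr (PiM I (\<lambda>_. std_gauss)) std_gauss (\<lambda>x. x t)"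
      by (rule distr_PiM_component[symmetric]) (use t N.prob_space_axioms in auto)
    also have "\<dots> = distr (PiM I (\<lambda>_. std_gauss)) borel (\<lambda>x. x t)"
      by (rule distr_cong) auto
    also have "\<dots> = distr M borel ((\<lambda>x. x t) \<circ> (\<lambda>s. \<lambda>t\<in>I. ?X t s))"
      unfolding D[symmetric] using t rv
      by (intro distr_distr measurable_component_singleton measurable_restrict) auto
    also have "\<dots> = distr M borel (?X t)"
      using t by (simp add: comp_def)
    finally show ?thesis by simp
  qed
  \<comment> \<open>The characterisation of independence by a product law is applied on a nonempty
    index set.\<close>
  have "(0, 0, 0) \<in> I" using p n by (simp add: I_def)
  then have "I \<noteq> {}" by blast
  from indep_vars_iff_distr_eq_PiM'[OF this rv]
  have iff: "indep_vars (\<lambda>_. borel) ?X I \<longleftrightarrow>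
      distr M (PiM I (\<lambda>_. borel)) (\<lambda>s. \<lambda>t\<in>I. ?X t s) = PiM I (\<lambda>t. distr M borel (?X t))" .
  have "PiM I (\<lambda>t. distr M borel (?X t)) = PiM I (\<lambda>_. std_gauss)"
    by (rule PiM_cong[OF refl d])
  then show "indep_vars (\<lambda>_. borel) ?X I"
    unfolding iff D by simp
  show "distributed M lborel (?X t) std_normal_density" if "t \<in> I" for t
  proof -
    have "distr M lborel (?X t) = distr M borel (?X t)"
      by (rule distr_cong) auto
    then show ?thesis
      using d[OF that] rv[OF that] by (simp add: distributed_def)
  qed
qed

text \<open>Whitening is affine and the weights \<open>1 / real n\<close> sum to 1, so it commutes
  with averaging.\<close>

lemma whiten_smean:
  assumes "0 < n"
  shows "whiten W p m (smean n x) j = (\<Sum>k<n. 1 / real n * whiten W p m (x k) j)"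
proof -
  have "smean n x l - m l = (\<Sum>k<n. 1 / real n * (x k l - m l))" for l
    unfolding sum_distrib_left[symmetric] sum_subtractf using assms
    by (simp add: smean_def right_diff_distrib)
  then have "whiten W p m (smean n x) j = (\<Sum>l<p. \<Sum>k<n. W j l * (1 / real n * (x k l - m l)))"
    by (simp only: whiten_def sum_distrib_left)
  also have "\<dots> = (\<Sum>k<n. \<Sum>l<p. W j l * (1 / real n * (x k l - m l)))"
    by (rule sum.swap)
  also have "\<dots> = (\<Sum>k<n. 1 / real n * whiten W p m (x k) j)"
    unfolding whiten_def sum_distrib_left by (intro sum.cong refl) simp
  finally show ?thesis .
qed

text \<open>Different pairs of class and coordinate average over disjoint blocks of independent
  variables, hence stay independent. Each average sums \<open>n i\<close> independent normals of
  standard deviation \<open>1 / n i\<close>, so its variance is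
  \<open>n i / (n i)^2 = 1 / n i\<close>.\<close>

lemma whitened_means_indep:
  fixes W :: "nat \<Rightarrow> nat \<Rightarrow> real" and n :: "nat \<Rightarrow> nat" and mu :: "nat \<Rightarrow> nat \<Rightarrow> real"
  assumes spd: "spd p S"
    and W: "\<And>j. j < p \<Longrightarrow> 0 < W j j" "\<And>j l. j < l \<Longrightarrow> W j l = 0"
      "\<And>a b. qform p S a b = (\<Sum>j<p. (\<Sum>l<p. W j l * a l) * (\<Sum>l<p. W j l * b l))"
      "det S * (\<Prod>j<p. W j j)\<^sup>2 = 1"
    and p: "0 < p" and n: "\<And>i. i \<in> {0, 1} \<Longrightarrow> 0 < n i"
  defines "M \<equiv> sample_distr p (n 0) (n 1) (mu 0) (mu 1) S"
    and "h \<equiv> \<lambda>(i, j) s. whiten W p (mu i) (smean (n i) (class_data i s)) j"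
  shows "prob_space.indep_vars M (\<lambda>_. borel) h ({0, 1} \<times> {..<p})"
    and "\<And>i j. i \<in> {0, 1} \<Longrightarrow> j < p \<Longrightarrow> distributed M lborel (h (i, j)) (normal_density 0 (1 / sqrt (n i)))"
proof -
  interpret prob_space M unfolding M_def by (rule prob_space_sample_distr[OF spd])
  let ?X = "whitened_coord W p mu"
  let ?I = "Sigma {0, 1} (\<lambda>i. {..<n i} \<times> {..<p})"
  have n0: "0 < n 0" using n by simp
  have X1: "indep_vars (\<lambda>_. borel) ?X ?I"
    unfolding M_def by (rule whitened_coords_indep(1)[where n = n and mu = mu, OF spd W p n0])
  have X2: "distributed M lborel (?X t) std_normal_density" if "t \<in> ?I" for t
    unfolding M_def by (rule whitened_coords_indep(2)[where n = n and mu = mu, OF spd W p n0 that])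
  have h: "h (i, j) s = (\<Sum>k<n i. 1 / real (n i) * ?X (i, k, j) s)" if "i \<in> {0, 1}" for i j s
    using n[OF that] by (simp add: h_def whitened_coord_def whiten_smean)
  \<comment> \<open>The block of observations that enter coordinate \<open>j\<close> of the mean of
    class \<open>i\<close>.\<close>
  define K where "K = (\<lambda>(i, j::nat). (\<lambda>k. (i, k, j)) ` {..<n i})"
  have KI: "K t \<subseteq> ?I" if "t \<in> {0, 1} \<times> {..<p}" for t
    using that by (auto simp: K_def)
  have "indep_vars (\<lambda>t. PiM (K t) (\<lambda>_. borel)) (\<lambda>t s. restrict (\<lambda>u. ?X u s) (K t)) ({0, 1} \<times> {..<p})"
    by (rule indep_vars_restrict[OF X1 KI]) (auto simp: disjoint_family_on_def K_def)
  then have "indep_vars (\<lambda>_. borel) (\<lambda>t s. (\<lambda>f. \<Sum>k<n (fst t). 1 / real (n (fst t)) * f (fst t, k, snd t))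
       (restrict (\<lambda>u. ?X u s) (K t))) ({0, 1} \<times> {..<p})"
    by (rule indep_vars_compose2)
      (auto intro!: borel_measurable_sum borel_measurable_times measurable_component_singleton simp: K_def)
  moreover have "h t s = (\<Sum>k<n (fst t). 1 / real (n (fst t)) * restrict (\<lambda>u. ?X u s) (K t) (fst t, k, snd t))"
    if t: "t \<in> {0, 1} \<times> {..<p}" for t s
  proof -
    obtain i j where ij: "t = (i, j)" "i \<in> {0, 1}" using t by blast
    have "(i, k, j) \<in> K (i, j)" if "k < n i" for k using that by (auto simp: K_def)
    then show ?thesis unfolding ij(1) h[OF ij(2)] by (intro sum.cong) auto
  qed
  then have "indep_vars (\<lambda>_. borel) h ({0, 1} \<times> {..<p}) \<longleftrightarrow>
      indep_vars (\<lambda>_. borel) (\<lambda>t s. (\<lambda>f. \<Sum>k<n (fst t). 1 / real (n (fst t)) * f (fst t, k, snd t))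
       (restrict (\<lambda>u. ?X u s) (K t))) ({0, 1} \<times> {..<p})"
    by (intro indep_vars_cong refl ext)
  ultimately show "indep_vars (\<lambda>_. borel) h ({0, 1} \<times> {..<p})" by (simp only:)
  fix i j :: nat assume i: "i \<in> {0, 1}" and j: "j < p"
  have "indep_vars (\<lambda>k. PiM {(i, k, j)} (\<lambda>_. borel)) (\<lambda>k s. restrict (\<lambda>u. ?X u s) {(i, k, j)}) {..<n i}"
    by (rule indep_vars_restrict[OF X1]) (use i j in \<open>auto simp: disjoint_family_on_def\<close>)
  then have "indep_vars (\<lambda>_. borel) (\<lambda>k s. (\<lambda>f. 1 / real (n i) * f (i, k, j)) (restrict (\<lambda>u. ?X u s) {(i, k, j)})) {..<n i}"
    by (rule indep_vars_compose2) (auto intro!: borel_measurable_times measurable_component_singleton)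
  then have Y: "indep_vars (\<lambda>_. borel) (\<lambda>k s. 1 / real (n i) * ?X (i, k, j) s) {..<n i}"
    by simp
  have ni: "0 < n i" by (rule n[OF i])
  have "distributed M lborel (\<lambda>s. \<Sum>k<n i. 1 / real (n i) * ?X (i, k, j) s)
     (normal_density (\<Sum>k<n i. 0) (sqrt (\<Sum>k<n i. (1 / real (n i))\<^sup>2)))"
  proof (rule sum_indep_normal[OF _ _ Y])
    fix k assume "k \<in> {..<n i}"
    then have "(i, k, j) \<in> ?I" using i j by auto
    from normal_density_affine[OF X2[OF this], of "1 / real (n i)" 0]
    show "distributed M lborel (\<lambda>s. 1 / real (n i) * ?X (i, k, j) s) (normal_density 0 (1 / real (n i)))"
      using ni by simp
  qed (use ni in auto)
  moreover have "(\<Sum>k<n i. (1 / real (n i))\<^sup>2) = 1 / real (n i)"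
    using ni by (simp add: power2_eq_square)
  then have "sqrt (\<Sum>k<n i. (1 / real (n i))\<^sup>2) = 1 / sqrt (n i)"
    by (simp only: real_sqrt_divide real_sqrt_one)
  moreover have "h (i, j) = (\<lambda>s. \<Sum>k<n i. 1 / real (n i) * ?X (i, k, j) s)"
    by (rule ext, rule h[OF i])
  ultimately show "distributed M lborel (h (i, j)) (normal_density 0 (1 / sqrt (n i)))"
    by (metis sum.neutral_const)
qed

section \<open>Convergence in probability as a filter\<close>

text \<open>A limit along \<open>in_prob M\<close> is a limit in probability: \<open>P\<close> holds eventually if, for all
  large \<open>p\<close>, it holds off measurable sets whose probability tends to 0.  Making this a filter
  gives access to the whole calculus of \<open>tendsto\<close>.\<close>

definition in_prob :: "(nat \<Rightarrow> 'a measure) \<Rightarrow> (nat \<times> 'a) filter" where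
  "in_prob M = Abs_filter (\<lambda>P. \<exists>A. (\<forall>p. A p \<in> sets (M p)) \<and> (\<lambda>p. measure (M p) (A p)) \<longlonglongrightarrow> 0 \<and>
      (\<forall>\<^sub>F p in sequentially. \<forall>s\<in>space (M p) - A p. P (p, s)))"

text \<open>Closure under conjunction is the point: exceptional sets are united, and the union still
  has vanishing probability by subadditivity.\<close>

lemma eventually_in_prob:
  assumes "\<And>p. prob_space (M p)"
  shows "eventually P (in_prob M) \<longleftrightarrow> (\<exists>A. (\<forall>p. A p \<in> sets (M p)) \<and>
      (\<lambda>p. measure (M p) (A p)) \<longlonglongrightarrow> 0 \<and>
      (\<forall>\<^sub>F p in sequentially. \<forall>s\<in>space (M p) - A p. P (p, s)))"
  unfolding in_prob_def
proof (rule eventually_Abs_filter, rule is_filter.intro, goal_cases)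
  case 1
  show ?case by (intro exI[of _ "\<lambda>_. {}"]) simp
next
  case (2 P Q)
  then obtain A B where A: "\<And>p. A p \<in> sets (M p)" "(\<lambda>p. measure (M p) (A p)) \<longlonglongrightarrow> 0"
      "\<forall>\<^sub>F p in sequentially. \<forall>s\<in>space (M p) - A p. P (p, s)"
    and B: "\<And>p. B p \<in> sets (M p)" "(\<lambda>p. measure (M p) (B p)) \<longlonglongrightarrow> 0"
      "\<forall>\<^sub>F p in sequentially. \<forall>s\<in>space (M p) - B p. Q (p, s)" by blast
  have "(\<lambda>p. measure (M p) (A p \<union> B p)) \<longlonglongrightarrow> 0"
  proof (rule tendsto_sandwich[OF _ _ tendsto_const])
    show "(\<lambda>p. measure (M p) (A p) + measure (M p) (B p)) \<longlonglongrightarrow> 0"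
      using tendsto_add[OF A(2) B(2)] by simp
    show "\<forall>\<^sub>F p in sequentially. measure (M p) (A p \<union> B p) \<le> measure (M p) (A p) + measure (M p) (B p)"
      using A(1) B(1) by (intro always_eventually allI measure_Un_le)
  qed simp
  moreover have "\<forall>\<^sub>F p in sequentially. \<forall>s\<in>space (M p) - (A p \<union> B p). P (p, s) \<and> Q (p, s)"
    using A(3) B(3) by eventually_elim blast
  ultimately show ?case using A(1) B(1) by (intro exI[of _ "\<lambda>p. A p \<union> B p"]) simp
next
  case (3 P Q)
  then obtain A where A: "\<forall>p. A p \<in> sets (M p)" "(\<lambda>p. measure (M p) (A p)) \<longlonglongrightarrow> 0"
      "\<forall>\<^sub>F p in sequentially. \<forall>s\<in>space (M p) - A p. P (p, s)" by blast
  from A(3) have "\<forall>\<^sub>F p in sequentially. \<forall>s\<in>space (M p) - A p. Q (p, s)"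
    by eventually_elim (use 3(1) in blast)
  with A(1,2) show ?case by blast
qed

text \<open>Empty exceptional sets suffice, so deterministic limits in \<open>p\<close> are limits
  in probability and mix freely with random ones.\<close>

lemma filterlim_fst_in_prob:
  assumes "\<And>p. prob_space (M p)"
  shows "filterlim fst sequentially (in_prob M)"
  unfolding filterlim_iff
proof (intro allI impI)
  fix P :: "nat \<Rightarrow> bool" assume "eventually P sequentially"
  then have "\<forall>\<^sub>F p in sequentially. \<forall>s\<in>space (M p) - {}. P (fst (p, s))"
    by eventually_elim simp
  then show "\<forall>\<^sub>F x in in_prob M. P (fst x)"
    unfolding eventually_in_prob[OF assms] by (intro exI[of _ "\<lambda>_. {}"]) simp
qed

lemma tendsto_in_prob_const:
  assumes "\<And>p. prob_space (M p)" "f \<longlonglongrightarrow> l"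
  shows "((\<lambda>x. f (fst x)) \<longlongrightarrow> l) (in_prob M)"
  by (rule filterlim_compose[OF assms(2) filterlim_fst_in_prob[OF assms(1)]])

text \<open>Chebyshev's inequality. Integrability is asked only eventually because the moment
  formulas are derived for \<open>0 < p\<close>.\<close>

lemma tendsto_in_prob_second_moment:
  fixes X :: "nat \<Rightarrow> 'a \<Rightarrow> real"
  assumes M: "\<And>p. prob_space (M p)"
    and meas: "\<And>p. X p \<in> borel_measurable (M p)"
    and int: "\<forall>\<^sub>F p in sequentially. integrable (M p) (\<lambda>s. (X p s)\<^sup>2)"
    and lim: "(\<lambda>p. \<integral>s. (X p s)\<^sup>2 \<partial>M p) \<longlonglongrightarrow> 0"
  shows "((\<lambda>x. X (fst x) (snd x)) \<longlongrightarrow> 0) (in_prob M)"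
  unfolding tendsto_iff
proof (intro allI impI)
  fix e :: real assume e: "e > 0"
  define A where "A p = {s \<in> space (M p). e\<^sup>2 \<le> (X p s)\<^sup>2}" for p
  have A: "A p \<in> sets (M p)" for p
    unfolding A_def using meas[of p] by measurable
  have "(\<lambda>p. measure (M p) (A p)) \<longlonglongrightarrow> 0"
  proof (rule tendsto_sandwich[OF _ _ tendsto_const])
    show "(\<lambda>p. (\<integral>s. (X p s)\<^sup>2 \<partial>M p) / e\<^sup>2) \<longlonglongrightarrow> 0"
      using tendsto_divide[OF lim tendsto_const[of "e\<^sup>2"]] e by simp
    show "\<forall>\<^sub>F p in sequentially. measure (M p) (A p) \<le> (\<integral>s. (X p s)\<^sup>2 \<partial>M p) / e\<^sup>2"
      using int
    proof eventually_elim
      case (elim p)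
      then show ?case unfolding A_def using e
        by (intro integral_Markov_inequality_measure[where A = "{}"]) auto
    qed
  qed simp
  moreover have "dist (X p s) 0 < e" if "s \<in> space (M p) - A p" for p s
  proof -
    have "(X p s)\<^sup>2 < e\<^sup>2" using that by (auto simp: A_def)
    then show ?thesis using e abs_le_square_iff[of e "X p s"] by auto
  qed
  ultimately show "\<forall>\<^sub>F x in in_prob M. dist (X (fst x) (snd x)) 0 < e"
    unfolding eventually_in_prob[OF M] using A by (intro exI[of _ A]) simp
qed

text \<open>Bounded convergence across varying spaces: off the exceptional set the deviation is
  below \<open>e / 2\<close>, and on it a fixed constant is multiplied by a vanishing
  probability.\<close>

lemma tendsto_expectation_in_prob:
  fixes f :: "nat \<Rightarrow> 'a \<Rightarrow> real"
  assumes M: "\<And>p. prob_space (M p)"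
    and meas: "\<And>p. f p \<in> borel_measurable (M p)"
    and bound: "\<And>p s. \<bar>f p s\<bar> \<le> B"
    and lim: "((\<lambda>x. f (fst x) (snd x)) \<longlongrightarrow> l) (in_prob M)"
  shows "(\<lambda>p. \<integral>s. f p s \<partial>M p) \<longlonglongrightarrow> l"
proof (rule LIMSEQ_I)
  fix e :: real assume e: "e > 0"
  \<comment> \<open>\<open>B + \<bar>l\<bar>\<close> bounds the deviation from \<open>l\<close>; the
    added 1 makes \<open>C\<close> positive, so that \<open>e / (2 * C)\<close> is a valid
    threshold.\<close>
  define C where "C = B + \<bar>l\<bar> + 1"
  have "B \<ge> 0" using bound[of 0 undefined] by linarith
  then have C: "C > 0" by (simp add: C_def)
  have "\<forall>\<^sub>F x in in_prob M. dist (f (fst x) (snd x)) l < e / 2"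
    by (rule tendstoD[OF lim]) (use e in simp)
  then obtain A where A: "\<And>p. A p \<in> sets (M p)" "(\<lambda>p. measure (M p) (A p)) \<longlonglongrightarrow> 0"
      "\<forall>\<^sub>F p in sequentially. \<forall>s\<in>space (M p) - A p. dist (f p s) l < e / 2"
    unfolding eventually_in_prob[OF M] by auto
  have "\<forall>\<^sub>F p in sequentially. dist (measure (M p) (A p)) 0 < e / (2 * C)"
    using tendstoD[OF A(2), of "e / (2 * C)"] e C by simp
  with A(3) have "\<forall>\<^sub>F p in sequentially. norm ((\<integral>s. f p s \<partial>M p) - l) < e"
  proof eventually_elim
    case (elim p)
    interpret prob_space "M p" by (rule M)
    have fint: "integrable (M p) (f p)"
      by (rule integrable_const_bound[of _ B]) (use bound meas in auto)
    have "(\<integral>s. f p s \<partial>M p) - l = (\<integral>s. f p s - l \<partial>M p)"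
      using fint by (simp add: prob_space)
    also have "norm \<dots> \<le> (\<integral>s. norm (f p s - l) \<partial>M p)"
      by (rule integral_norm_bound)
    also have "\<dots> \<le> (\<integral>s. e / 2 + C * indicator (A p) s \<partial>M p)"
    proof (rule integral_mono)
      fix s assume s: "s \<in> space (M p)"
      show "norm (f p s - l) \<le> e / 2 + C * indicator (A p) s"
      proof (cases "s \<in> A p")
        case True
        then show ?thesis using bound[of p s] e by (simp add: C_def)
      next
        case False
        with elim(1) s have "dist (f p s) l < e / 2" by auto
        with False show ?thesis by (simp add: dist_real_def)
      qed
    qed (use fint A(1) in \<open>auto simp: less_top[symmetric]\<close>)
    also have "\<dots> = e / 2 + C * measure (M p) (A p)"
      using A(1)[of p] by (simp add: prob_space less_top[symmetric] sets.Int_space_eq2)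
    also have "\<dots> < e"
      using elim(2) C e by (simp add: dist_real_def field_simps)
    finally show ?case .
  qed
  then show "\<exists>no. \<forall>n\<ge>no. norm ((\<integral>s. f n s \<partial>M n) - l) < e"
    by (simp add: eventually_sequentially)
qed

section \<open>The standard normal distribution function\<close>

lemma Phi_eq_cdf: "Phi x = cdf (density lborel std_normal_density) x"
  by (simp add: Phi_def cdf_def)

text \<open>A distribution function is continuous where its measure has no atom, and a density
  against Lebesgue measure has none.\<close>

lemma isCont_Phi: "isCont Phi x"
proof -
  interpret prob_space "density lborel (\<lambda>x. ennreal (std_normal_density x))"
    by (rule prob_space_normal_density) simp
  interpret finite_borel_measure "density lborel (\<lambda>x. ennreal (std_normal_density x))"
    by unfold_locales simp
  have "emeasure (density lborel (\<lambda>x. ennreal (std_normal_density x))) {x} = 0"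
    using AE_lborel_singleton[of x]
    by (subst emeasure_density) (auto simp: nn_integral_0_iff_AE indicator_def elim!: eventually_mono)
  then have "isCont (cdf (density lborel (\<lambda>x. ennreal (std_normal_density x)))) x"
    by (simp add: isCont_cdf measure_def)
  then show ?thesis by (simp add: Phi_eq_cdf[abs_def])
qed

lemma borel_measurable_Phi [measurable]: "Phi \<in> borel_measurable borel"
  by (intro borel_measurable_continuous_onI continuous_at_imp_continuous_on ballI isCont_Phi)

lemma abs_Phi_le_1: "\<bar>Phi x\<bar> \<le> 1"
proof -
  interpret prob_space "density lborel (\<lambda>x. ennreal (std_normal_density x))"
    by (rule prob_space_normal_density) simp
  show ?thesis by (simp add: Phi_def)
qed

section \<open>The asymptotic regime\<close>

lemma qform_lincomb_left:
  "qform p S (\<lambda>j. u * a j + v * b j) d = u * qform p S a d + v * qform p S b d"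
  unfolding qform_def sum_distrib_left sum.distrib[symmetric]
  by (intro sum.cong refl) (simp add: algebra_simps)

lemma qform_lincomb_right:
  "qform p S d (\<lambda>j. u * a j + v * b j) = u * qform p S d a + v * qform p S d b"
  unfolding qform_def sum_distrib_left sum.distrib[symmetric]
  by (intro sum.cong refl) (simp add: algebra_simps)

lemma qform_add_right: "qform p S d (\<lambda>j. a j + b j) = qform p S d a + qform p S d b"
  using qform_lincomb_right[of p S d 1 a 1 b] by simp

lemma qform_add_left: "qform p S (\<lambda>j. a j + b j) d = qform p S a d + qform p S b d"
  using qform_lincomb_left[of p S 1 a 1 b d] by simp

lemma qform_diff_right: "qform p S d (\<lambda>j. a j - b j) = qform p S d a - qform p S d b"
  using qform_lincomb_right[of p S d 1 a "-1" b] by simp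

lemma qform_diff_left: "qform p S (\<lambda>j. a j - b j) d = qform p S a d - qform p S b d"
  using qform_lincomb_left[of p S 1 a "-1" b d] by simp

lemma qform_sym:
  assumes "spd p S"
  shows "qform p S a b = qform p S b a"
proof -
  have "qform p S a b = (\<Sum>j<p. \<Sum>i<p. a i * (minv S $$ (i, j)) * b j)"
    unfolding qform_def by (rule sum.swap)
  also have "\<dots> = qform p S b a"
    unfolding qform_def using minv_sym[OF assms] by (intro sum.cong refl) simp
  finally show ?thesis .
qed

lemma eta_expand:
  assumes "spd p S"
  shows "eta p S a b = qform p S a a - 2 * qform p S a b + qform p S b b"
  unfolding eta_def qform_diff_left qform_diff_right using qform_sym[OF assms, of b a] by simp

lemma borel_measurable_qform:
  assumes "\<And>l. l < p \<Longrightarrow> (\<lambda>s. f s l) \<in> borel_measurable N" "\<And>l. l < p \<Longrightarrow> (\<lambda>s. g s l) \<in> borel_measurable N"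
  shows "(\<lambda>s. qform p S (f s) (g s)) \<in> borel_measurable N"
  unfolding qform_def by (intro borel_measurable_sum borel_measurable_times borel_measurable_const assms) auto

text \<open>Chooses a whitening matrix and eliminates it again: from here on only
  \<open>qform\<close> appears. The values are arranged as products of \<open>p / n\<close>, which
  converges, with \<open>1 / n\<close>, which vanishes.\<close>

lemma sample_second_moments:
  fixes n :: "nat \<Rightarrow> nat" and mu :: "nat \<Rightarrow> nat \<Rightarrow> real"
  assumes spd: "spd p S" and p: "0 < p" and n: "\<And>i. i \<in> {0, 1} \<Longrightarrow> 0 < n i"
  defines "M \<equiv> sample_distr p (n 0) (n 1) (mu 0) (mu 1) S"
    and "z \<equiv> \<lambda>i s l. smean (n i) (class_data i s) l - mu i l"
  shows "\<And>i a. i \<in> {0, 1} \<Longrightarrow> integrable M (\<lambda>s. (qform p S a (z i s))\<^sup>2)"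
    and "\<And>i a. i \<in> {0, 1} \<Longrightarrow> (\<integral>s. (qform p S a (z i s))\<^sup>2 \<partial>M) = qform p S a a / real (n i)"
    and "\<And>i. i \<in> {0, 1} \<Longrightarrow> integrable M (\<lambda>s. (qform p S (z i s) (z i s) - real p / real (n i))\<^sup>2)"
    and "\<And>i. i \<in> {0, 1} \<Longrightarrow> (\<integral>s. (qform p S (z i s) (z i s) - real p / real (n i))\<^sup>2 \<partial>M)
       = 2 * (real p / real (n i)) / real (n i)"
    and "integrable M (\<lambda>s. (qform p S (z 0 s) (z 1 s))\<^sup>2)"
    and "(\<integral>s. (qform p S (z 0 s) (z 1 s))\<^sup>2 \<partial>M) = real p / real (n 0) / real (n 1)"
proof -
  obtain W where W: "\<And>j. j < p \<Longrightarrow> 0 < W j j" "\<And>j l. j < l \<Longrightarrow> W j l = 0"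
    "\<And>a b. qform p S a b = (\<Sum>j<p. (\<Sum>l<p. W j l * a l) * (\<Sum>l<p. W j l * b l))"
    "det S * (\<Prod>j<p. W j j)\<^sup>2 = 1"
    by (rule whitening_exists[OF spd]) blast
  interpret prob_space M unfolding M_def by (rule prob_space_sample_distr[OF spd])
  define h where "h = (\<lambda>(i, j) s. whiten W p (mu i) (smean (n i) (class_data i s)) j)"
  define \<sigma> where "\<sigma> i = 1 / sqrt (real (n i))" for i
  have h: "(\<Sum>l<p. W j l * z i s l) = h (i, j) s" for i j s
    by (simp add: h_def whiten_def z_def)
  note I = whitened_means_indep[where n = n and mu = mu, OF spd W p n, folded M_def h_def \<sigma>_def]
  have \<sigma>: "0 < \<sigma> i" if "i \<in> {0, 1}" for i
    using n[OF that] by (simp add: \<sigma>_def)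
  have \<sigma>2: "(\<sigma> i)\<^sup>2 = 1 / real (n i)" for i by (simp add: \<sigma>_def power_divide)
  have \<sigma>4: "(\<sigma> i) ^ 4 = 1 / real (n i) / real (n i)" for i
    using \<sigma>2[of i] by (simp add: power4_eq_xxxx power2_eq_square)
  note lin = second_moment_linear[OF I(1) \<sigma> I(2)]
  note chi = second_moment_chi_square[OF I(1) \<sigma> I(2)]
  note cross = second_moment_cross[OF I(1) \<sigma> I(2)]
  note q = W(3)
  show "integrable M (\<lambda>s. (qform p S a (z i s))\<^sup>2)" if "i \<in> {0, 1}" for i a
    unfolding q h by (rule lin(1)) (use that in auto)
  show "(\<integral>s. (qform p S a (z i s))\<^sup>2 \<partial>M) = qform p S a a / real (n i)" if "i \<in> {0, 1}" for i a
    unfolding q h by (subst lin(2)) (use that in \<open>auto simp: \<sigma>2\<close>)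
  show "integrable M (\<lambda>s. (qform p S (z i s) (z i s) - real p / real (n i))\<^sup>2)" if "i \<in> {0, 1}" for i
    unfolding q h using chi(1)[of i] that by (simp add: \<sigma>2)
  show "(\<integral>s. (qform p S (z i s) (z i s) - real p / real (n i))\<^sup>2 \<partial>M)
       = 2 * (real p / real (n i)) / real (n i)" if "i \<in> {0, 1}" for i
    unfolding q h using chi(2)[of i] that by (simp add: \<sigma>2 \<sigma>4)
  show "integrable M (\<lambda>s. (qform p S (z 0 s) (z 1 s))\<^sup>2)"
    unfolding q h by (rule cross(1)) auto
  show "(\<integral>s. (qform p S (z 0 s) (z 1 s))\<^sup>2 \<partial>M) = real p / real (n 0) / real (n 1)"
    unfolding q h by (subst cross(2)) (auto simp: \<sigma>2)
qed

text \<open>Holds what the two classes share. The prior mean and certainty of the class under study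
  are passed separately, so that a single limit argument serves \<open>i = 0\<close> and
  \<open>i = 1\<close>.\<close>

locale lda_asymptotics =
  fixes Sig :: "nat \<Rightarrow> real mat" and n :: "nat \<Rightarrow> nat \<Rightarrow> nat" and mu :: "nat \<Rightarrow> nat \<Rightarrow> nat \<Rightarrow> real"
    and J :: "nat \<Rightarrow> real" and a :: "nat \<Rightarrow> nat \<Rightarrow> real"
  assumes spd: "\<And>p. spd p (Sig p)"
    and n_pos: "\<And>i p. i \<in> {0, 1} \<Longrightarrow> 0 < n i p"
    and n_inf: "\<And>i. i \<in> {0, 1} \<Longrightarrow> filterlim (\<lambda>p. real (n i p)) at_top sequentially"
    and J: "\<And>i. i \<in> {0, 1} \<Longrightarrow> (\<lambda>p. real p / real (n i p)) \<longlonglongrightarrow> J i"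
    and mu_mu: "\<And>i j. i \<in> {0, 1} \<Longrightarrow> j \<in> {0, 1} \<Longrightarrow> (\<lambda>p. qform p (Sig p) (mu i p) (mu j p)) \<longlonglongrightarrow> a i j"
begin

abbreviation q :: "nat \<Rightarrow> (nat \<Rightarrow> real) \<Rightarrow> (nat \<Rightarrow> real) \<Rightarrow> real" where
  "q p \<equiv> qform p (Sig p)"

definition M :: "nat \<Rightarrow> ((nat \<Rightarrow> nat \<Rightarrow> real) \<times> (nat \<Rightarrow> nat \<Rightarrow> real)) measure" where
  "M p = sample_distr p (n 0 p) (n 1 p) (mu 0 p) (mu 1 p) (Sig p)"

definition xbar :: "nat \<Rightarrow> nat \<Rightarrow> (nat \<Rightarrow> nat \<Rightarrow> real) \<times> (nat \<Rightarrow> nat \<Rightarrow> real) \<Rightarrow> nat \<Rightarrow> real" where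
  "xbar i p s = smean (n i p) (class_data i s)"

definition z :: "nat \<Rightarrow> nat \<Rightarrow> (nat \<Rightarrow> nat \<Rightarrow> real) \<times> (nat \<Rightarrow> nat \<Rightarrow> real) \<Rightarrow> nat \<Rightarrow> real" where
  "z i p s l = xbar i p s l - mu i p l"

lemma prob_space_M: "prob_space (M p)"
  unfolding M_def by (rule prob_space_sample_distr[OF spd])

lemma borel_measurable_xbar:
  assumes "i \<in> {0, 1}" "l < p"
  shows "(\<lambda>s. xbar i p s l) \<in> borel_measurable (M p)"
  unfolding xbar_def smean_def M_def
  by (intro borel_measurable_divide borel_measurable_sum borel_measurable_const
      borel_measurable_class_data[where n = "\<lambda>i. n i p" and mu = "\<lambda>i. mu i p"] assms) auto

lemma borel_measurable_z:
  assumes "i \<in> {0, 1}" "l < p"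
  shows "(\<lambda>s. z i p s l) \<in> borel_measurable (M p)"
  unfolding z_def by (intro borel_measurable_diff borel_measurable_const borel_measurable_xbar assms)

lemma second_moments:
  assumes "0 < p"
  shows "i \<in> {0, 1} \<Longrightarrow> integrable (M p) (\<lambda>s. (q p b (z i p s))\<^sup>2)"
    and "i \<in> {0, 1} \<Longrightarrow> (\<integral>s. (q p b (z i p s))\<^sup>2 \<partial>M p) = q p b b / real (n i p)"
    and "i \<in> {0, 1} \<Longrightarrow> integrable (M p) (\<lambda>s. (q p (z i p s) (z i p s) - real p / real (n i p))\<^sup>2)"
    and "i \<in> {0, 1} \<Longrightarrow> (\<integral>s. (q p (z i p s) (z i p s) - real p / real (n i p))\<^sup>2 \<partial>M p)
       = 2 * (real p / real (n i p)) / real (n i p)"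
    and "integrable (M p) (\<lambda>s. (q p (z 0 p s) (z 1 p s))\<^sup>2)"
    and "(\<integral>s. (q p (z 0 p s) (z 1 p s))\<^sup>2 \<partial>M p) = real p / real (n 0 p) / real (n 1 p)"
  using sample_second_moments[where n = "\<lambda>i. n i p" and mu = "\<lambda>i. mu i p", OF spd assms n_pos]
  unfolding M_def z_def[abs_def] xbar_def by blast+

lemma inverse_n_tendsto: "i \<in> {0, 1} \<Longrightarrow> (\<lambda>p. inverse (real (n i p))) \<longlonglongrightarrow> 0"
  by (rule tendsto_inverse_0_at_top[OF n_inf])

text \<open>The second moment is the convergent squared norm of \<open>b p\<close> divided by the
  sample size.\<close>

lemma q_z_tendsto:
  assumes i: "i \<in> {0, 1}" and b: "convergent (\<lambda>p. q p (b p) (b p))"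
  shows "((\<lambda>x. q (fst x) (b (fst x)) (z i (fst x) (snd x))) \<longlongrightarrow> 0) (in_prob M)"
proof (rule tendsto_in_prob_second_moment[OF prob_space_M])
  show "(\<lambda>s. q p (b p) (z i p s)) \<in> borel_measurable (M p)" for p
    using borel_measurable_z[OF i] by (intro borel_measurable_qform) auto
  show "\<forall>\<^sub>F p in sequentially. integrable (M p) (\<lambda>s. (q p (b p) (z i p s))\<^sup>2)"
    using eventually_gt_at_top[of 0] by eventually_elim (rule second_moments(1)[OF _ i])
  obtain l where "(\<lambda>p. q p (b p) (b p)) \<longlonglongrightarrow> l" using b by (auto simp: convergent_def)
  from tendsto_mult[OF this inverse_n_tendsto[OF i]]
  have "(\<lambda>p. q p (b p) (b p) / real (n i p)) \<longlonglongrightarrow> 0" by (simp add: divide_inverse)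
  then show "(\<lambda>p. \<integral>s. (q p (b p) (z i p s))\<^sup>2 \<partial>M p) \<longlonglongrightarrow> 0"
    by (rule Lim_transform_eventually)
      (use eventually_gt_at_top[of 0] in \<open>eventually_elim, simp add: second_moments(2)[OF _ i]\<close>)
qed

text \<open>Centred at its mean \<open>p / n\<close>, the form has second moment
  \<open>2 * (p / n) / n\<close>, which vanishes; the mean itself tends to
  \<open>J i\<close>.\<close>

lemma z_z_tendsto:
  assumes i: "i \<in> {0, 1}"
  shows "((\<lambda>x. q (fst x) (z i (fst x) (snd x)) (z i (fst x) (snd x))) \<longlongrightarrow> J i) (in_prob M)"
proof -
  have "((\<lambda>x. q (fst x) (z i (fst x) (snd x)) (z i (fst x) (snd x)) - real (fst x) / real (n i (fst x)))
     \<longlongrightarrow> 0) (in_prob M)"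
  proof (rule tendsto_in_prob_second_moment[OF prob_space_M])
    show "(\<lambda>s. q p (z i p s) (z i p s) - real p / real (n i p)) \<in> borel_measurable (M p)" for p
      using borel_measurable_z[OF i] by (intro borel_measurable_diff borel_measurable_const borel_measurable_qform) auto
    show "\<forall>\<^sub>F p in sequentially. integrable (M p) (\<lambda>s. (q p (z i p s) (z i p s) - real p / real (n i p))\<^sup>2)"
      using eventually_gt_at_top[of 0] by eventually_elim (rule second_moments(3)[OF _ i])
    from tendsto_mult[OF tendsto_mult[OF tendsto_const[of 2] J[OF i]] inverse_n_tendsto[OF i]]
    have "(\<lambda>p. 2 * (real p / real (n i p)) / real (n i p)) \<longlonglongrightarrow> 0" by (simp add: divide_inverse)
    then show "(\<lambda>p. \<integral>s. (q p (z i p s) (z i p s) - real p / real (n i p))\<^sup>2 \<partial>M p) \<longlonglongrightarrow> 0"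
      by (rule Lim_transform_eventually)
        (use eventually_gt_at_top[of 0] in \<open>eventually_elim, simp add: second_moments(4)[OF _ i]\<close>)
  qed
  from tendsto_add[OF this tendsto_in_prob_const[OF prob_space_M J[OF i]]]
  show ?thesis by simp
qed

lemma z0_z1_tendsto:
  "((\<lambda>x. q (fst x) (z 0 (fst x) (snd x)) (z 1 (fst x) (snd x))) \<longlongrightarrow> 0) (in_prob M)"
proof (rule tendsto_in_prob_second_moment[OF prob_space_M])
  show "(\<lambda>s. q p (z 0 p s) (z 1 p s)) \<in> borel_measurable (M p)" for p
    using borel_measurable_z by (intro borel_measurable_qform) auto
  show "\<forall>\<^sub>F p in sequentially. integrable (M p) (\<lambda>s. (q p (z 0 p s) (z 1 p s))\<^sup>2)"
    using eventually_gt_at_top[of 0] by eventually_elim (rule second_moments(5))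
  have "(\<lambda>p. real p / real (n 0 p) * inverse (real (n 1 p))) \<longlonglongrightarrow> J 0 * 0"
    by (intro tendsto_mult J inverse_n_tendsto) auto
  then have "(\<lambda>p. real p / real (n 0 p) / real (n 1 p)) \<longlonglongrightarrow> 0" by (simp add: divide_inverse)
  then show "(\<lambda>p. \<integral>s. (q p (z 0 p s) (z 1 p s))\<^sup>2 \<partial>M p) \<longlonglongrightarrow> 0"
    by (rule Lim_transform_eventually)
      (use eventually_gt_at_top[of 0] in \<open>eventually_elim, simp only: second_moments(6)\<close>)
qed

lemma xbar_eq: "xbar i p s = (\<lambda>l. mu i p l + z i p s l)"
  by (simp add: z_def)

lemma q_xbar_tendsto:
  assumes i: "i \<in> {0, 1}" and bb: "convergent (\<lambda>p. q p (b p) (b p))"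
    and bmu: "(\<lambda>p. q p (b p) (mu i p)) \<longlonglongrightarrow> l"
  shows "((\<lambda>x. q (fst x) (b (fst x)) (xbar i (fst x) (snd x))) \<longlongrightarrow> l) (in_prob M)"
  using tendsto_add[OF tendsto_in_prob_const[OF prob_space_M bmu] q_z_tendsto[OF i bb]]
  unfolding xbar_eq qform_add_right by simp

text \<open>Splitting each mean into signal and noise, the two mixed terms vanish, and the pure
  noise term survives only within one class.\<close>

lemma xbar_xbar_tendsto:
  assumes i: "i \<in> {0, 1}" and j: "j \<in> {0, 1}"
  shows "((\<lambda>x. q (fst x) (xbar i (fst x) (snd x)) (xbar j (fst x) (snd x)))
    \<longlongrightarrow> a i j + (if i = j then J i else 0)) (in_prob M)"
proof -
  have zz: "((\<lambda>x. q (fst x) (z i (fst x) (snd x)) (z j (fst x) (snd x)))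
    \<longlongrightarrow> (if i = j then J i else 0)) (in_prob M)"
  proof (cases "i = j")
    case True
    then show ?thesis using z_z_tendsto[OF i] by simp
  next
    case False
    then consider "i = 0" "j = 1" | "i = 1" "j = 0" using i j by auto
    then show ?thesis
    proof cases
      case 1
      then show ?thesis using z0_z1_tendsto by simp
    next
      case 2
      then show ?thesis using z0_z1_tendsto qform_sym[OF spd, of _ "z (Suc 0) _ _" "z 0 _ _"] by simp
    qed
  qed
  have conv: "convergent (\<lambda>p. q p (mu k p) (mu k p))" if "k \<in> {0, 1}" for k
    using mu_mu[OF that that] by (auto simp: convergent_def)
  have "((\<lambda>x. q (fst x) (mu i (fst x)) (mu j (fst x)) + q (fst x) (mu i (fst x)) (z j (fst x) (snd x))
     + (q (fst x) (mu j (fst x)) (z i (fst x) (snd x)) + q (fst x) (z i (fst x) (snd x)) (z j (fst x) (snd x))))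
    \<longlongrightarrow> a i j + 0 + (0 + (if i = j then J i else 0))) (in_prob M)"
    by (intro tendsto_add zz q_z_tendsto i j conv tendsto_in_prob_const[OF prob_space_M mu_mu])
  moreover have "q p (xbar i p s) (xbar j p s) = q p (mu i p) (mu j p) + q p (mu i p) (z j p s)
     + (q p (mu j p) (z i p s) + q p (z i p s) (z j p s))" for p s
    unfolding xbar_eq qform_add_right qform_add_left
    using qform_sym[OF spd, of p "z i p s" "mu j p"] by simp
  ultimately show ?thesis by simp
qed

end

text \<open>Presents the estimator as an explicit function of finitely many forms with known limits.
  The posterior mean is a convex combination of sample mean and prior mean; in the midpoint term the
  mixed products cancel by symmetry, leaving half the difference of the squared norms.\<close>

lemma bayes_eps_eq:
  assumes S: "spd p S" and pos: "0 < real ni + nui"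
  shows "bayes_eps i c p S ni nui mi x0 x1 = Phi ((-1) ^ i *
     ((- (real ni / (real ni + nui) * (qform p S (if i = 0 then x0 else x1) x0 - qform p S (if i = 0 then x0 else x1) x1)
        + nui / (real ni + nui) * (qform p S mi x0 - qform p S mi x1)
        - (qform p S x0 x0 - qform p S x1 x1) / 2) + c)
      / sqrt (qform p S x0 x0 - 2 * qform p S x0 x1 + qform p S x1 x1))
     * sqrt ((real ni + nui) / (real ni + nui + 1)))"
proof -
  define xi where "xi = (if i = 0 then x0 else x1)"
  let ?d = "\<lambda>j. x0 j - x1 j"
  have "(\<lambda>j. (real ni * xi j + nui * mi j) / (real ni + nui))
      = (\<lambda>j. real ni / (real ni + nui) * xi j + nui / (real ni + nui) * mi j)"
    by (simp add: add_divide_distrib)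
  then have mstar: "qform p S (\<lambda>j. (real ni * xi j + nui * mi j) / (real ni + nui)) d
      = real ni / (real ni + nui) * qform p S xi d + nui / (real ni + nui) * qform p S mi d" for d
    by (simp only: qform_lincomb_left)
  have "(\<lambda>j. (x0 j + x1 j) / 2) = (\<lambda>j. 1 / 2 * x0 j + 1 / 2 * x1 j)" by auto
  then have mid: "qform p S (\<lambda>j. (x0 j + x1 j) / 2) d = 1 / 2 * qform p S x0 d + 1 / 2 * qform p S x1 d" for d
    by (simp only: qform_lincomb_left)
  have sym: "qform p S x1 x0 = qform p S x0 x1" by (rule qform_sym[OF S])
  have "qform p S ?d ?d = qform p S x0 x0 - 2 * qform p S x0 x1 + qform p S x1 x1"
    unfolding qform_diff_left qform_diff_right sym by simp
  moreover have "qform p S (\<lambda>j. (real ni * xi j + nui * mi j) / (real ni + nui) - (x0 j + x1 j) / 2) ?d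
     = real ni / (real ni + nui) * (qform p S xi x0 - qform p S xi x1)
        + nui / (real ni + nui) * (qform p S mi x0 - qform p S mi x1)
        - (qform p S x0 x0 - qform p S x1 x1) / 2"
    unfolding qform_diff_left mstar mid qform_diff_right sym
      right_diff_distrib diff_divide_distrib by simp
  ultimately show ?thesis
    unfolding bayes_eps_def Let_def xi_def[symmetric] by (simp only: mult.assoc)
qed

context lda_asymptotics
begin

text \<open>The arithmetic inside \<open>Phi\<close> is continuous at the limit point because
  \<open>D\<close> keeps the limiting denominator away from zero; \<open>Phi\<close> is bounded, so
  the limit passes to the expectation. Integrability is exported so that the mixture over the
  classes can be split later.\<close>

lemma expectation_bayes_eps_tendsto:
  fixes nu :: "nat \<Rightarrow> real" and m :: "nat \<Rightarrow> nat \<Rightarrow> real" and b :: "nat \<Rightarrow> real" and \<gamma> c :: real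
  assumes i: "i \<in> {0, 1}"
    and nu_pos: "\<And>p. 0 < nu p"
    and \<gamma>: "(\<lambda>p. nu p / real (n i p)) \<longlonglongrightarrow> \<gamma>"
    and mm: "convergent (\<lambda>p. q p (m p) (m p))"
    and b: "\<And>j. j \<in> {0, 1} \<Longrightarrow> (\<lambda>p. q p (m p) (mu j p)) \<longlonglongrightarrow> b j"
    and D: "0 < a 0 0 + J 0 - 2 * a 0 1 + (a 1 1 + J 1)"
  defines "f \<equiv> \<lambda>p s. bayes_eps i c p (Sig p) (n i p) (nu p) (m p) (xbar 0 p s) (xbar 1 p s)"
  shows "integrable (M p) (f p)"
    and "(\<lambda>p. \<integral>s. f p s \<partial>M p) \<longlonglongrightarrow> Phi ((-1) ^ i *
     ((- (1 / (1 + \<gamma>) * (a i 0 + (if i = 0 then J i else 0) - (a i 1 + (if i = 1 then J i else 0)))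
        + \<gamma> / (1 + \<gamma>) * (b 0 - b 1) - (a 0 0 + J 0 - (a 1 1 + J 1)) / 2) + c)
      / sqrt (a 0 0 + J 0 - 2 * a 0 1 + (a 1 1 + J 1))))"
proof -
  have pos: "0 < real (n i p) + nu p" for p using nu_pos[of p] by simp
  have xi: "(if i = 0 then xbar 0 p s else xbar 1 p s) = xbar i p s" for p s using i by auto
  have f_eq: "f p s = Phi ((-1) ^ i *
     ((- (real (n i p) / (real (n i p) + nu p) * (q p (xbar i p s) (xbar 0 p s) - q p (xbar i p s) (xbar 1 p s))
        + nu p / (real (n i p) + nu p) * (q p (m p) (xbar 0 p s) - q p (m p) (xbar 1 p s))
        - (q p (xbar 0 p s) (xbar 0 p s) - q p (xbar 1 p s) (xbar 1 p s)) / 2) + c)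
      / sqrt (q p (xbar 0 p s) (xbar 0 p s) - 2 * q p (xbar 0 p s) (xbar 1 p s) + q p (xbar 1 p s) (xbar 1 p s)))
     * sqrt ((real (n i p) + nu p) / (real (n i p) + nu p + 1)))" for p s
    by (simp only: f_def bayes_eps_eq[OF spd pos] xi)
  have meas: "f p \<in> borel_measurable (M p)" for p
  proof -
    have [measurable]: "(\<lambda>s. q p (xbar j p s) (xbar k p s)) \<in> borel_measurable (M p)"
        "(\<lambda>s. q p (m p) (xbar j p s)) \<in> borel_measurable (M p)"
      if "j \<in> {0, 1}" "k \<in> {0, 1}" for j k
      using that borel_measurable_xbar by (auto intro!: borel_measurable_qform)
    note [measurable] = this[OF i] this[of 0 0] this[of 0 1] this[of 1 1]
    show ?thesis unfolding f_eq[abs_def] by measurable (use i in auto)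
  qed
  have bound: "\<bar>f p s\<bar> \<le> 1" for p s
    unfolding f_eq by (rule abs_Phi_le_1)
  interpret prob_space "M p" by (rule prob_space_M)
  show "integrable (M p) (f p)"
    by (rule integrable_const_bound[of _ 1]) (use bound meas in auto)
  \<comment> \<open>Needed for \<open>1 + \<gamma>\<close> to be nonzero.\<close>
  have "\<gamma> \<ge> 0"
    by (rule LIMSEQ_le_const[OF \<gamma>]) (intro exI[of _ 0] allI impI divide_nonneg_nonneg less_imp_le[OF nu_pos] of_nat_0_le_iff)
  have n0: "real (n i p) > 0" for p using n_pos[OF i] by simp
  \<comment> \<open>Dividing numerator and denominator by the sample size expresses the posterior
    weights through the convergent ratio \<open>nu p / n\<close>.\<close>
  have "(\<lambda>p. 1 / (1 + nu p / real (n i p))) \<longlonglongrightarrow> 1 / (1 + \<gamma>)"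
    using \<open>\<gamma> \<ge> 0\<close> by (intro tendsto_intros \<gamma>) auto
  moreover have "1 / (1 + nu p / real (n i p)) = real (n i p) / (real (n i p) + nu p)" for p
    using n0[of p] nu_pos[of p] by (simp add: field_simps)
  ultimately have t1: "(\<lambda>p. real (n i p) / (real (n i p) + nu p)) \<longlonglongrightarrow> 1 / (1 + \<gamma>)" by (simp only:)
  have "(\<lambda>p. nu p / real (n i p) / (1 + nu p / real (n i p))) \<longlonglongrightarrow> \<gamma> / (1 + \<gamma>)"
    using \<open>\<gamma> \<ge> 0\<close> by (intro tendsto_intros \<gamma>) auto
  moreover have "nu p / real (n i p) / (1 + nu p / real (n i p)) = nu p / (real (n i p) + nu p)" for p
    using n0[of p] nu_pos[of p] by (simp add: field_simps)
  ultimately have t2: "(\<lambda>p. nu p / (real (n i p) + nu p)) \<longlonglongrightarrow> \<gamma> / (1 + \<gamma>)" by (simp only:)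
  \<comment> \<open>The certainty factor is \<open>sqrt (1 - 1 / (\<nu> + 1))\<close> with
    \<open>\<nu>\<close> the posterior certainty, which grows without bound.\<close>
  have "filterlim (\<lambda>p. real (n i p) + (nu p + 1)) at_top sequentially"
    by (rule filterlim_at_top_mono[OF n_inf[OF i]]) (simp add: nu_pos less_imp_le add_pos_pos)
  from tendsto_inverse_0_at_top[OF this]
  have "(\<lambda>p. sqrt (1 - inverse (real (n i p) + (nu p + 1)))) \<longlonglongrightarrow> sqrt (1 - 0)"
    by (intro tendsto_intros)
  moreover have "1 - inverse (real (n i p) + (nu p + 1)) = (real (n i p) + nu p) / (real (n i p) + nu p + 1)" for p
    using pos[of p] by (simp add: field_simps)
  ultimately have t3: "(\<lambda>p. sqrt ((real (n i p) + nu p) / (real (n i p) + nu p + 1))) \<longlonglongrightarrow> 1" by simp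
  note const = tendsto_in_prob_const[OF prob_space_M]
  note xx = xbar_xbar_tendsto
  note mx = q_xbar_tendsto[OF _ mm b]
  let ?q = "\<lambda>j k x. q (fst x) (xbar j (fst x) (snd x)) (xbar k (fst x) (snd x))"
  have x00: "(?q 0 0 \<longlongrightarrow> a 0 0 + J 0) (in_prob M)" and x01: "(?q 0 1 \<longlongrightarrow> a 0 1) (in_prob M)"
    and x11: "(?q 1 1 \<longlongrightarrow> a 1 1 + J 1) (in_prob M)"
    using xx[of 0 0] xx[of 0 1] xx[of 1 1] by simp_all
  have xi0: "(?q i 0 \<longlongrightarrow> a i 0 + (if i = 0 then J i else 0)) (in_prob M)"
    and xi1: "(?q i 1 \<longlongrightarrow> a i 1 + (if i = 1 then J i else 0)) (in_prob M)"
    using xx[OF i, of 0] xx[OF i, of 1] by simp_all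
  \<comment> \<open>The trailing \<open>* 1\<close> is the limit of the certainty factor; it keeps
    the limit in the same shape as \<open>f_eq\<close> for the limit rules.\<close>
  have "((\<lambda>x. f (fst x) (snd x)) \<longlongrightarrow> Phi ((-1) ^ i *
     ((- (1 / (1 + \<gamma>) * (a i 0 + (if i = 0 then J i else 0) - (a i 1 + (if i = 1 then J i else 0)))
        + \<gamma> / (1 + \<gamma>) * (b 0 - b 1) - (a 0 0 + J 0 - (a 1 1 + J 1)) / 2) + c)
      / sqrt (a 0 0 + J 0 - 2 * a 0 1 + (a 1 1 + J 1))) * 1)) (in_prob M)"
    unfolding f_eq
    using D by (intro isCont_tendsto_compose[OF isCont_Phi] tendsto_intros const[OF t1] const[OF t2] const[OF t3]
        xi0 xi1 x00 x01 x11 mx) auto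
  from tendsto_expectation_in_prob[OF prob_space_M meas bound this]
  show "(\<lambda>p. \<integral>s. f p s \<partial>M p) \<longlonglongrightarrow> Phi ((-1) ^ i *
     ((- (1 / (1 + \<gamma>) * (a i 0 + (if i = 0 then J i else 0) - (a i 1 + (if i = 1 then J i else 0)))
        + \<gamma> / (1 + \<gamma>) * (b 0 - b 1) - (a 0 0 + J 0 - (a 1 1 + J 1)) / 2) + c)
      / sqrt (a 0 0 + J 0 - 2 * a 0 1 + (a 1 1 + J 1))))" by simp
qed

end

section \<open>Limits for both classes and for their mixture\<close>

theorem theorem1:
  fixes alpha0 :: real
    and Sig :: "nat \<Rightarrow> real mat"
    and mu0 mu1 m0 m1 :: "nat \<Rightarrow> nat \<Rightarrow> real"
    and n0 n1 :: "nat \<Rightarrow> nat"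
    and nu0 nu1 :: "nat \<Rightarrow> real"
    and J0 J1 gamma0 gamma1 :: real
  assumes alpha0: "0 < alpha0" "alpha0 < 1"
    and spd: "\<And>p. spd p (Sig p)"
    and npos: "\<And>p. 0 < n0 p" "\<And>p. 0 < n1 p"
    and nupos: "\<And>p. 0 < nu0 p" "\<And>p. 0 < nu1 p"
    and n_inf: "filterlim (\<lambda>p. real (n0 p)) at_top sequentially"
               "filterlim (\<lambda>p. real (n1 p)) at_top sequentially"
    and nu_inf: "filterlim nu0 at_top sequentially" "filterlim nu1 at_top sequentially"
    and J: "(\<lambda>p. real p / real (n0 p)) \<longlonglongrightarrow> J0" "(\<lambda>p. real p / real (n1 p)) \<longlonglongrightarrow> J1"
    and gamma: "(\<lambda>p. nu0 p / real (n0 p)) \<longlonglongrightarrow> gamma0" "(\<lambda>p. nu1 p / real (n1 p)) \<longlonglongrightarrow> gamma1"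
    and bilin: "\<And>a b. a \<in> {m0, m1, mu0, mu1} \<Longrightarrow> b \<in> {m0, m1, mu0, mu1} \<Longrightarrow>
                  convergent (\<lambda>p. qform p (Sig p) (a p) (b p))"
    and Dpos: "lim (\<lambda>p. eta p (Sig p) (mu0 p) (mu1 p)) + J0 + J1 > 0"
  shows
    "let c = ln ((1 - alpha0) / alpha0);
         alpha1 = 1 - alpha0;
         delta2 = lim (\<lambda>p. eta p (Sig p) (mu0 p) (mu1 p));
         D = delta2 + J0 + J1;
         G0 = 1 / (2 * (1 + gamma0)) *
                (gamma0 * (lim (\<lambda>p. eta p (Sig p) (m0 p) (mu1 p)) - lim (\<lambda>p. eta p (Sig p) (m0 p) (mu0 p)))
                 + delta2 + (1 - gamma0) * J0 + (1 + gamma0) * J1);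
         G1 = -1 / (2 * (1 + gamma1)) *
                (gamma1 * (lim (\<lambda>p. eta p (Sig p) (m1 p) (mu0 p)) - lim (\<lambda>p. eta p (Sig p) (m1 p) (mu1 p)))
                 + delta2 + (1 - gamma1) * J1 + (1 + gamma1) * J0);
         E0 = (\<lambda>p. \<integral>s. bayes_eps 0 c p (Sig p) (n0 p) (nu0 p) (m0 p)
                        (smean (n0 p) (fst s)) (smean (n1 p) (snd s))
                     \<partial>sample_distr p (n0 p) (n1 p) (mu0 p) (mu1 p) (Sig p));
         E1 = (\<lambda>p. \<integral>s. bayes_eps 1 c p (Sig p) (n1 p) (nu1 p) (m1 p)
                        (smean (n0 p) (fst s)) (smean (n1 p) (snd s))
                     \<partial>sample_distr p (n0 p) (n1 p) (mu0 p) (mu1 p) (Sig p));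
         E = (\<lambda>p. \<integral>s. alpha0 * bayes_eps 0 c p (Sig p) (n0 p) (nu0 p) (m0 p)
                                   (smean (n0 p) (fst s)) (smean (n1 p) (snd s))
                        + alpha1 * bayes_eps 1 c p (Sig p) (n1 p) (nu1 p) (m1 p)
                                   (smean (n0 p) (fst s)) (smean (n1 p) (snd s))
                     \<partial>sample_distr p (n0 p) (n1 p) (mu0 p) (mu1 p) (Sig p))
     in (E0 \<longlonglongrightarrow> Phi ((-1) ^ 0 * ((- G0 + c) / sqrt D)))
      \<and> (E1 \<longlonglongrightarrow> Phi ((-1) ^ 1 * ((- G1 + c) / sqrt D)))
      \<and> (E \<longlonglongrightarrow> alpha0 * Phi ((- G0 + c) / sqrt D) + alpha1 * Phi ((G1 - c) / sqrt D))"
proof -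
  define n :: "nat \<Rightarrow> nat \<Rightarrow> nat" where "n i = (if i = 0 then n0 else n1)" for i
  define mu :: "nat \<Rightarrow> nat \<Rightarrow> nat \<Rightarrow> real" where "mu i = (if i = 0 then mu0 else mu1)" for i
  define J :: "nat \<Rightarrow> real" where "J i = (if i = 0 then J0 else J1)" for i
  define L where "L u v = lim (\<lambda>p. qform p (Sig p) (u p) (v p))" for u v :: "nat \<Rightarrow> nat \<Rightarrow> real"
  have L: "(\<lambda>p. qform p (Sig p) (u p) (v p)) \<longlonglongrightarrow> L u v"
    if "u \<in> {m0, m1, mu0, mu1}" "v \<in> {m0, m1, mu0, mu1}" for u v
    unfolding L_def using bilin[OF that] by (simp add: convergent_LIMSEQ_iff)
  have L_sym: "L u v = L v u" for u v
    unfolding L_def using qform_sym[OF spd] by metis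
  \<comment> \<open>Polarisation: every limit of \<open>eta\<close> in the statement becomes a
    combination of the limits \<open>L\<close>, in which the algebra below is carried out.\<close>
  have lim_eta: "lim (\<lambda>p. eta p (Sig p) (u p) (v p)) = L u u - 2 * L u v + L v v"
    if "u \<in> {m0, m1, mu0, mu1}" "v \<in> {m0, m1, mu0, mu1}" for u v
    unfolding eta_expand[OF spd] using that by (intro limI tendsto_intros L)
  interpret lda_asymptotics Sig n mu J "\<lambda>i j. L (mu i) (mu j)"
    by unfold_locales (use spd npos n_inf J L in \<open>auto simp: n_def mu_def J_def\<close>)
  define c where "c = ln ((1 - alpha0) / alpha0)"
  have D: "0 < L (mu 0) (mu 0) + J 0 - 2 * L (mu 0) (mu 1) + (L (mu 1) (mu 1) + J 1)"
    using Dpos lim_eta[of mu0 mu1] by (simp add: mu_def J_def)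
  have gamma_nonneg: "gamma0 \<ge> 0" "gamma1 \<ge> 0"
    by (rule LIMSEQ_le_const[OF gamma(1)] LIMSEQ_le_const[OF gamma(2)],
        intro exI[of _ 0] allI impI divide_nonneg_nonneg less_imp_le[OF nupos(1)] less_imp_le[OF nupos(2)]
          of_nat_0_le_iff)+
  have M_eq: "M p = sample_distr p (n0 p) (n1 p) (mu0 p) (mu1 p) (Sig p)" for p
    by (simp add: M_def n_def mu_def)
  have x_eq: "xbar 0 p s = smean (n0 p) (fst s)" "xbar 1 p s = smean (n1 p) (snd s)" for p s
    by (simp_all add: xbar_def n_def class_data_def)
  define f0 where "f0 p s = bayes_eps 0 c p (Sig p) (n0 p) (nu0 p) (m0 p) (smean (n0 p) (fst s)) (smean (n1 p) (snd s))" for p s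
  define f1 where "f1 p s = bayes_eps 1 c p (Sig p) (n1 p) (nu1 p) (m1 p) (smean (n0 p) (fst s)) (smean (n1 p) (snd s))" for p s
  define delta2 where "delta2 = lim (\<lambda>p. eta p (Sig p) (mu0 p) (mu1 p))"
  define G0 where "G0 = 1 / (2 * (1 + gamma0)) *
      (gamma0 * (lim (\<lambda>p. eta p (Sig p) (m0 p) (mu1 p)) - lim (\<lambda>p. eta p (Sig p) (m0 p) (mu0 p)))
        + delta2 + (1 - gamma0) * J0 + (1 + gamma0) * J1)"
  define G1 where "G1 = -1 / (2 * (1 + gamma1)) *
      (gamma1 * (lim (\<lambda>p. eta p (Sig p) (m1 p) (mu0 p)) - lim (\<lambda>p. eta p (Sig p) (m1 p) (mu1 p)))
        + delta2 + (1 - gamma1) * J1 + (1 + gamma1) * J0)"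
  have D_eq: "L (mu 0) (mu 0) + J 0 - 2 * L (mu 0) (mu 1) + (L (mu 1) (mu 1) + J 1) = delta2 + J0 + J1"
    unfolding delta2_def by (simp add: lim_eta mu_def J_def)
  note E0 = expectation_bayes_eps_tendsto[where i = 0 and nu = nu0 and \<gamma> = gamma0 and m = m0
      and b = "\<lambda>j. L m0 (mu j)" and c = c, OF _ nupos(1) _ _ _ D, unfolded D_eq]
  note E1 = expectation_bayes_eps_tendsto[where i = 1 and nu = nu1 and \<gamma> = gamma1 and m = m1
      and b = "\<lambda>j. L m1 (mu j)" and c = c, OF _ nupos(2) _ _ _ D, unfolded D_eq]
  have conv: "convergent (\<lambda>p. qform p (Sig p) (m0 p) (m0 p))" "convergent (\<lambda>p. qform p (Sig p) (m1 p) (m1 p))"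
    by (rule bilin; simp)+
  have Lm: "(\<lambda>p. qform p (Sig p) (m0 p) (mu j p)) \<longlonglongrightarrow> L m0 (mu j)"
    "(\<lambda>p. qform p (Sig p) (m1 p) (mu j p)) \<longlonglongrightarrow> L m1 (mu j)" for j
    by (rule L; simp add: mu_def)+
  have g: "(\<lambda>p. nu0 p / real (n 0 p)) \<longlonglongrightarrow> gamma0" "(\<lambda>p. nu1 p / real (n 1 p)) \<longlonglongrightarrow> gamma1"
    using gamma by (simp_all add: n_def)
  have f_eq: "f0 p s = bayes_eps 0 c p (Sig p) (n 0 p) (nu0 p) (m0 p) (xbar 0 p s) (xbar 1 p s)"
    "f1 p s = bayes_eps 1 c p (Sig p) (n 1 p) (nu1 p) (m1 p) (xbar 0 p s) (xbar 1 p s)" for p s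
    unfolding f0_def f1_def x_eq by (simp_all add: n_def)
  have int: "integrable (M p) (f0 p)" "integrable (M p) (f1 p)" for p
    unfolding f_eq[abs_def] by (rule E0(1) E1(1); (rule g conv Lm | simp))+
  \<comment> \<open>Brings the limiting argument to the common prefactor
    \<open>1 / (2 * (1 + g))\<close> in which \<open>G0\<close> and \<open>G1\<close> are written;
    nonnegativity of \<open>g\<close> excludes a zero denominator.\<close>
  have comb: "1 / (1 + g) * X + g / (1 + g) * Y - Z / 2 = 1 / (2 * (1 + g)) * (2 * X + 2 * g * Y - (1 + g) * Z)"
    if "g \<ge> 0" for g X Y Z :: real
  proof -
    have "k \<noteq> 0 \<Longrightarrow> 1 / k * X + g / k * Y - Z / 2 = 1 / (2 * k) * (2 * X + 2 * g * Y - k * Z)" for k :: real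
      by (simp add: field_simps)
    then show ?thesis using that by simp
  qed
  \<comment> \<open>In the difference of the two \<open>eta\<close> limits with \<open>m0\<close>,
    the square of \<open>m0\<close> cancels. What remains is twice the prior mean term plus a
    difference of squared class means, and the latter completes the coefficients
    \<open>1 - gamma0\<close> and \<open>1 + gamma0\<close> of the squares of \<open>mu 0\<close>
    and \<open>mu 1\<close>.\<close>
  have "1 / (1 + gamma0) * (L (mu 0) (mu 0) + (if (0::nat) = 0 then J 0 else 0)
       - (L (mu 0) (mu 1) + (if (0::nat) = 1 then J 0 else 0)))
      + gamma0 / (1 + gamma0) * (L m0 (mu 0) - L m0 (mu 1))
      - (L (mu 0) (mu 0) + J 0 - (L (mu 1) (mu 1) + J 1)) / 2 = G0"
    unfolding comb[OF gamma_nonneg(1)] G0_def delta2_def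
    by (rule arg_cong[where f = "\<lambda>x. 1 / (2 * (1 + gamma0)) * x"])
      (simp add: lim_eta mu_def J_def algebra_simps)
  moreover have "(\<lambda>p. \<integral>s. f0 p s \<partial>M p) \<longlonglongrightarrow> Phi ((-1) ^ 0 * ((- (1 / (1 + gamma0) * (L (mu 0) (mu 0) + (if (0::nat) = 0 then J 0 else 0)
       - (L (mu 0) (mu 1) + (if (0::nat) = 1 then J 0 else 0)))
      + gamma0 / (1 + gamma0) * (L m0 (mu 0) - L m0 (mu 1))
      - (L (mu 0) (mu 0) + J 0 - (L (mu 1) (mu 1) + J 1)) / 2) + c) / sqrt (delta2 + J0 + J1)))"
    unfolding f_eq by (rule E0(2)) (rule g conv Lm | simp)+
  ultimately have lim0: "(\<lambda>p. \<integral>s. f0 p s \<partial>M p) \<longlonglongrightarrow> Phi ((-1) ^ 0 * ((- G0 + c) / sqrt (delta2 + J0 + J1)))"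
    by (simp only:)
  \<comment> \<open>For class 1 its own mean is the subtracted one, so \<open>J 1\<close> comes with
    a negative sign and the whole expression is the mirror image of class 0. The minus sign of
    \<open>G1\<close> is moved inside before the brackets are compared.\<close>
  have "1 / (1 + gamma1) * (L (mu 1) (mu 0) + (if (1::nat) = 0 then J 1 else 0)
       - (L (mu 1) (mu 1) + (if (1::nat) = 1 then J 1 else 0)))
      + gamma1 / (1 + gamma1) * (L m1 (mu 0) - L m1 (mu 1))
      - (L (mu 0) (mu 0) + J 0 - (L (mu 1) (mu 1) + J 1)) / 2 = G1"
    unfolding comb[OF gamma_nonneg(2)] G1_def delta2_def L_sym[of "mu 1" "mu 0"]
      minus_divide_left[symmetric] mult_minus_left mult_minus_right[symmetric]
    by (rule arg_cong[where f = "\<lambda>x. 1 / (2 * (1 + gamma1)) * x"])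
      (simp add: lim_eta mu_def J_def algebra_simps)
  moreover have "(\<lambda>p. \<integral>s. f1 p s \<partial>M p) \<longlonglongrightarrow> Phi ((-1) ^ 1 * ((- (1 / (1 + gamma1) * (L (mu 1) (mu 0) + (if (1::nat) = 0 then J 1 else 0)
       - (L (mu 1) (mu 1) + (if (1::nat) = 1 then J 1 else 0)))
      + gamma1 / (1 + gamma1) * (L m1 (mu 0) - L m1 (mu 1))
      - (L (mu 0) (mu 0) + J 0 - (L (mu 1) (mu 1) + J 1)) / 2) + c) / sqrt (delta2 + J0 + J1)))"
    unfolding f_eq by (rule E1(2)) (rule g conv Lm | simp)+
  ultimately have lim1: "(\<lambda>p. \<integral>s. f1 p s \<partial>M p) \<longlonglongrightarrow> Phi ((-1) ^ 1 * ((- G1 + c) / sqrt (delta2 + J0 + J1)))"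
    by (simp only:)
  have "(\<lambda>p. alpha0 * (\<integral>s. f0 p s \<partial>M p) + (1 - alpha0) * (\<integral>s. f1 p s \<partial>M p)) \<longlonglongrightarrow>
      alpha0 * Phi ((-1) ^ 0 * ((- G0 + c) / sqrt (delta2 + J0 + J1)))
      + (1 - alpha0) * Phi ((-1) ^ 1 * ((- G1 + c) / sqrt (delta2 + J0 + J1)))"
    by (intro tendsto_intros lim0 lim1)
  moreover have "(\<integral>s. alpha0 * f0 p s + (1 - alpha0) * f1 p s \<partial>M p)
      = alpha0 * (\<integral>s. f0 p s \<partial>M p) + (1 - alpha0) * (\<integral>s. f1 p s \<partial>M p)" for p
    using int by simp
  \<comment> \<open>The class sign is absorbed into the numerator, which yields the
    \<open>G1 - c\<close> of the mixture.\<close>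
  moreover have "(-1) ^ 1 * ((- G1 + c) / sqrt (delta2 + J0 + J1)) = (G1 - c) / sqrt (delta2 + J0 + J1)"
    by (simp add: field_simps)
  ultimately have limE: "(\<lambda>p. \<integral>s. alpha0 * f0 p s + (1 - alpha0) * f1 p s \<partial>M p) \<longlonglongrightarrow>
      alpha0 * Phi ((- G0 + c) / sqrt (delta2 + J0 + J1)) + (1 - alpha0) * Phi ((G1 - c) / sqrt (delta2 + J0 + J1))"
    by simp
  show ?thesis
    unfolding Let_def c_def[symmetric] delta2_def[symmetric] G0_def[symmetric] G1_def[symmetric]
      f0_def[symmetric] f1_def[symmetric] M_eq[symmetric]
    using lim0 lim1 limE by (intro conjI)
qed

end
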